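(* Let $d\in\mathbb{N}$, $\sigma>0$, and let $X_1,\dots,X_n$, $Y_1,\dots,Y_n$, $\pi^\star$ be generated according to Model LD (described in the context) with parameters $\|\cdot\|$, $R_d,\gamma>0$ and $\beta\ge\log 2$. Then for all $n\ge 3$, $$\inf_{\hat\pi}\mathbb{E}\left[d_H(\hat\pi,\pi^\star)\right]\ \ge\ \frac{\gamma^2}{32}\,e^{-7\beta d}\left((n^2\sigma^d)\wedge n\right),$$ where the infimum is taken over all estimators $\hat\pi$.
   Context: Model. $X_1,\dots,X_n$ are i.i.d. random vectors in $\mathbb{R}^d$, $Z_1,\dots,Z_n$ are i.i.d. random vectors in $\mathbb{R}^d$, $\pi^\star$ is uniform on the symmetric group $S_n$; the $X$'s, the $Z$'s and $\pi^\star$ are mutually independent; and $Y_i=X_{\pi^\star(i)}+Z_i$ for $i\in[n]=\{1,\dots,n\}$. An estimator $\hat\pi$ is a (measurable) map taking $(X_1,\dots,X_n,Y_1,\dots,Y_n)$ to a permutation in $S_n$. The Hamming distance is $d_H(\hat\pi,\pi^\star)=\sum_{j=1}^n\mathbf 1[\hat\pi(j)\ne\pi^\star(j)]$. We write $a\wedge b=\min(a,b)$. Model LD. The observations are $X_1,\dots,X_n$ and $Y_i=X_{\pi^\star(i)}+Z_i$, $i\in[n]$, where $X_1,\dots,X_n$ are i.i.d. in $\mathbb{R}^d$, $Z_1,\dots,Z_n$ are i.i.d. in $\mathbb{R}^d$, $\pi^\star$ is uniform on $S_n$, and the $X$'s, the $Z$'s and $\pi^\star$ are mutually independent. Assume in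 addition: (a) $X_1,\dots,X_n\sim\mathcal P$ i.i.d., where $\mathcal P$ is a probability distribution on $\mathbb{R}^d$ such that (i) $\mathcal P(\{x\in\mathbb{R}^d:\|x\|<R_d\})\ge\gamma$ for some norm $\|\cdot\|$ on $\mathbb{R}^d$ and some $R_d,\gamma>0$; (ii) $\mathcal P$ has a density $f_{\mathcal P}$ with respect to Lebesgue measure such that $$\frac{\operatorname{ess\,sup}_{\|x\|<R_d}f_{\mathcal P}(x)}{\operatorname{ess\,inf}_{\|x\|<R_d}f_{\mathcal P}(x)}\le e^{\beta d}$$ for some constant $\beta\ge\log 2$. (b) $Z_i=\sigma\tilde Z_i$ with $\sigma>0$ and $\tilde Z_1,\dots,\tilde Z_n\sim\mathcal Q$ i.i.d., where $\mathcal Q$ is a distribution on $\mathbb{R}^d$ with $$\sup_{\|v\|<R_d}\left\|\mathcal Q(v)\otimes\mathcal Q(-v)-\mathcal Q\otimes\mathcal Q\right\|_{TV}\le 1-e^{-\beta d},$$ where $\otimes$ is the product of measures, $\mathcal Q(v)$ is the law of $\tilde Z_1+v$, $\|\cdot\|_{TV}$ is the total variation distance (normalized to lie in $[0,1]$), and $\|\cdot\|$, $R_d$, $\beta$ are the same as in (a). *)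

theory Defs
  imports "HOL-Probability.Probability"
begin

definition is_norm :: "('a::real_vector \<Rightarrow> real) \<Rightarrow> bool" where
  "is_norm N \<longleftrightarrow>
     (\<forall>x. 0 \<le> N x) \<and> (\<forall>x. N x = 0 \<longleftrightarrow> x = 0) \<and>
     (\<forall>a x. N (a *\<^sub>R x) = \<bar>a\<bar> * N x) \<and> (\<forall>x y. N (x + y) \<le> N x + N y)"

(* Sup over all measurable events, so the value lies in [0,1] for probability measures. *)
definition tv_dist :: "'a measure \<Rightarrow> 'a measure \<Rightarrow> real" where
  "tv_dist \<mu> \<nu> = (SUP A\<in>sets \<mu>. \<bar>measure \<mu> A - measure \<nu> A\<bar>)"

(* Dual to the library's esssup (cf. esssup_eq_AE). *)
definition essinf :: "'a measure \<Rightarrow> ('a \<Rightarrow> ennreal) \<Rightarrow> ennreal" where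
  "essinf M f = Sup {z. AE x in M. z \<le> f x}"

definition translate :: "'a::real_normed_vector measure \<Rightarrow> 'a \<Rightarrow> 'a measure" where
  "translate Q v = distr Q borel (\<lambda>z. z + v)"

(* The quotient is taken in ennreal. The conventions 0/0 = 0 and top/top = 0 are harmless:
   P has mass at least \<gamma> > 0 and at most 1 on the ball, so there the essential supremum
   of f is nonzero and the essential infimum is finite. *)
definition signal_condition ::
  "((real ^ 'd) \<Rightarrow> real) \<Rightarrow> real \<Rightarrow> real \<Rightarrow> real \<Rightarrow> (real ^ 'd) measure \<Rightarrow> bool" where
  "signal_condition N R \<gamma> \<beta> P \<longleftrightarrow>
     prob_space P \<and> sets P = sets borel \<and>
     measure P {x. N x < R} \<ge> \<gamma> \<and>
     (\<exists>f :: (real ^ 'd) \<Rightarrow> real.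
        f \<in> borel_measurable borel \<and> (\<forall>x. 0 \<le> f x) \<and>
        P = density lborel (\<lambda>x. ennreal (f x)) \<and>
        esssup (restrict_space lborel {x. N x < R}) (\<lambda>x. ennreal (f x))
          / essinf (restrict_space lborel {x. N x < R}) (\<lambda>x. ennreal (f x))
          \<le> ennreal (exp (\<beta> * real CARD('d))))"

definition noise_condition ::
  "((real ^ 'd) \<Rightarrow> real) \<Rightarrow> real \<Rightarrow> real \<Rightarrow> (real ^ 'd) measure \<Rightarrow> bool" where
  "noise_condition N R \<beta> Q \<longleftrightarrow>
     prob_space Q \<and> sets Q = sets borel \<and>
     (SUP v\<in>{v. N v < R}. tv_dist (translate Q v \<Otimes>\<^sub>M translate Q (- v)) (Q \<Otimes>\<^sub>M Q))
       \<le> 1 - exp (- \<beta> * real CARD('d))"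

definition sym_group :: "nat \<Rightarrow> (nat \<Rightarrow> nat) set" where
  "sym_group n = {p. p permutes {1..n}}"

definition iid :: "'w measure \<Rightarrow> 'i set \<Rightarrow> ('i \<Rightarrow> 'w \<Rightarrow> 'a::topological_space) \<Rightarrow> bool" where
  "iid M I X \<longleftrightarrow>
     prob_space.indep_vars M (\<lambda>_. borel) X I \<and>
     (\<forall>i\<in>I. \<forall>j\<in>I. distr M borel (X i) = distr M borel (X j))"

abbreviation tuple_space :: "nat \<Rightarrow> (nat \<Rightarrow> 'a::topological_space) measure" where
  "tuple_space n \<equiv> (\<Pi>\<^sub>M i\<in>{1..n}. borel)"

definition tuple :: "nat \<Rightarrow> (nat \<Rightarrow> 'w \<Rightarrow> 'a) \<Rightarrow> 'w \<Rightarrow> (nat \<Rightarrow> 'a)" where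
  "tuple n X \<omega> = (\<lambda>i\<in>{1..n}. X i \<omega>)"

(* indep_vars needs a common codomain type, so mutual independence of the X's, the Z's and
   the permutation is stated for the three sigma-algebras they generate. *)
locale permuted_model = prob_space M
  for M :: "'w measure" +
  fixes n :: nat
    and X Z :: "nat \<Rightarrow> 'w \<Rightarrow> real ^ 'd"
    and \<pi> :: "'w \<Rightarrow> nat \<Rightarrow> nat"
    and Y :: "nat \<Rightarrow> 'w \<Rightarrow> real ^ 'd"
  assumes iid_X: "iid M {1..n} X"
    and iid_Z: "iid M {1..n} Z"
    and \<pi>_measurable: "\<pi> \<in> measurable M (count_space (sym_group n))"
    and \<pi>_uniform:
      "distr M (count_space (sym_group n)) \<pi> = uniform_count_measure (sym_group n)"
    and mutually_indep:
      "indep_sets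
         (\<lambda>k. if k = 0 then {tuple n X -` A \<inter> space M |A. A \<in> sets (tuple_space n)}
              else if k = 1 then {tuple n Z -` A \<inter> space M |A. A \<in> sets (tuple_space n)}
              else {\<pi> -` A \<inter> space M |A. A \<subseteq> sym_group n})
         {0, 1, 2 :: nat}"
    and Y_eq: "\<And>i \<omega>. i \<in> {1..n} \<Longrightarrow> \<omega> \<in> space M \<Longrightarrow> Y i \<omega> = X (\<pi> \<omega> i) \<omega> + Z i \<omega>"

locale model_LD = permuted_model M n X Z \<pi> Y
  for M :: "'w measure" and n :: nat
    and X Z :: "nat \<Rightarrow> 'w \<Rightarrow> real ^ 'd"
    and \<pi> :: "'w \<Rightarrow> nat \<Rightarrow> nat"
    and Y :: "nat \<Rightarrow> 'w \<Rightarrow> real ^ 'd" +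
  fixes N :: "(real ^ 'd) \<Rightarrow> real"
    and R \<gamma> \<beta> \<sigma> :: real
    and P Q :: "(real ^ 'd) measure"
    and Zt :: "nat \<Rightarrow> 'w \<Rightarrow> real ^ 'd"
  assumes norm_N: "is_norm N"
    and R_pos: "R > 0"
    and \<gamma>_pos: "\<gamma> > 0"
    and \<beta>_ge: "\<beta> \<ge> ln 2"
    and \<sigma>_pos: "\<sigma> > 0"
    and X_law: "\<And>i. i \<in> {1..n} \<Longrightarrow> distr M borel (X i) = P"
    and signal: "signal_condition N R \<gamma> \<beta> P"
    and Z_eq: "\<And>i \<omega>. i \<in> {1..n} \<Longrightarrow> \<omega> \<in> space M \<Longrightarrow> Z i \<omega> = \<sigma> *\<^sub>R Zt i \<omega>"
    and iid_Zt: "iid M {1..n} Zt"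
    and Zt_law: "\<And>i. i \<in> {1..n} \<Longrightarrow> distr M borel (Zt i) = Q"
    and noise: "noise_condition N R \<beta> Q"

definition hamming_dist :: "nat \<Rightarrow> (nat \<Rightarrow> nat) \<Rightarrow> (nat \<Rightarrow> nat) \<Rightarrow> real" where
  "hamming_dist n p q = (\<Sum>j\<in>{1..n}. of_bool (p j \<noteq> q j))"

definition estimators ::
  "nat \<Rightarrow> ((nat \<Rightarrow> 'a::topological_space) \<times> (nat \<Rightarrow> 'a) \<Rightarrow> nat \<Rightarrow> nat) set" where
  "estimators n =
     measurable (tuple_space n \<Otimes>\<^sub>M tuple_space n) (count_space (sym_group n))"

end

theory Submission
  imports Defs
begin

text \<open>
  If \<open>X\<^sub>i\<close> and \<open>X\<^sub>j\<close> are within distance \<open>\<sigma>R\<close>, the noise condition, applied with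
  \<open>v = (X\<^sub>j - X\<^sub>i) / \<sigma>\<close>, bounds the total variation between the laws of the observations under
  \<open>\<pi>\<close> and under \<open>(i j) \<circ> \<pi>\<close>. Since the two permutations have different preimages of \<open>i\<close>,
  averaging over this measure-preserving involution shows that the preimage of \<open>i\<close> is
  misestimated with conditional probability at least \<open>e\<^sup>-\<^sup>\<beta>\<^sup>d / 2\<close>. The close pairs need not
  be disjoint: it suffices to count the \<open>i\<close> that have some close \<open>j\<close>. If \<open>X\<^sub>i\<close> lies in the
  ball of radius \<open>R\<close>, an event of probability at least \<open>\<gamma>\<close>, then that ball contains a ball of
  radius \<open>min 1 \<sigma> * R / 2\<close> all of whose points are close to \<open>X\<^sub>i\<close>, and comparing its volume
  with that of the whole ball gives it mass at least
  \<open>\<gamma> e\<^sup>-\<^sup>2\<^sup>\<beta>\<^sup>d min 1 (\<sigma>\<^sup>d)\<close>.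
\<close>

subsection \<open>Mass of small balls under the signal\<close>

text \<open>One half of the equivalence of norms in finite dimension, obtained by expanding a vector
  in \<open>Basis\<close>. It makes N continuous and hence Borel measurable, which the purely
  algebraic predicate \<open>is_norm\<close> does not assert.\<close>

lemma is_norm_lipschitz:
  fixes N :: "'a::euclidean_space \<Rightarrow> real"
  assumes "is_norm N"
  obtains C where "\<And>x y. \<bar>N x - N y\<bar> \<le> C * norm (x - y)"
proof
  fix x y :: 'a
  have N_scale: "N (a *\<^sub>R z) = \<bar>a\<bar> * N z" and N_tri: "N (z + w) \<le> N z + N w"
    and N_ge0: "0 \<le> N z" for a z w
    using assms by (auto simp: is_norm_def)
  have N_sum: "N (\<Sum>b\<in>S. f b) \<le> (\<Sum>b\<in>S. N (f b))" if "finite S" for S :: "'a set" and f :: "'a \<Rightarrow> 'a"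
    using that
  proof (induction S rule: finite_induct)
    case empty
    show ?case using N_scale[of 0 0] by simp
  next
    case (insert b S)
    then show ?case using N_tri[of "f b" "sum f S"] by simp
  qed
  have le: "N z \<le> (\<Sum>b\<in>Basis. N b) * norm z" for z
  proof -
    have "N z = N (\<Sum>b\<in>Basis. (z \<bullet> b) *\<^sub>R b)"
      by (simp add: euclidean_representation)
    also have "\<dots> \<le> (\<Sum>b\<in>Basis. \<bar>z \<bullet> b\<bar> * N b)"
      using N_sum[of Basis "\<lambda>b. (z \<bullet> b) *\<^sub>R b"] by (simp add: N_scale)
    also have "\<dots> \<le> (\<Sum>b\<in>Basis. norm z * N b)"
      by (intro sum_mono mult_right_mono N_ge0 Basis_le_norm)
    finally show ?thesis
      by (simp add: sum_distrib_left mult.commute)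
  qed
  have "N x \<le> N y + N (x - y)" "N y \<le> N x + N (y - x)"
    using N_tri[of y "x - y"] N_tri[of x "y - x"] by simp_all
  then show "\<bar>N x - N y\<bar> \<le> (\<Sum>b\<in>Basis. N b) * norm (x - y)"
    using le[of "x - y"] le[of "y - x"] by (simp add: norm_minus_commute abs_le_iff)
qed

lemma is_norm_measurable:
  fixes N :: "'a::euclidean_space \<Rightarrow> real"
  assumes "is_norm N"
  shows "N \<in> borel_measurable borel"
proof -
  obtain C where C: "\<bar>N x - N y\<bar> \<le> C * norm (x - y)" for x y
    using is_norm_lipschitz[OF assms] by blast
  have "isCont N x" for x
    unfolding isCont_def
  proof (rule LIM_zero_cancel, rule Lim_null_comparison)
    show "\<forall>\<^sub>F y in at x. norm (N y - N x) \<le> C * norm (y - x)"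
      using C by simp
    show "((\<lambda>y. C * norm (y - x)) \<longlongrightarrow> 0) (at x)"
      by (intro tendsto_eq_intros refl) auto
  qed
  then show ?thesis
    by (intro borel_measurable_continuous_onI continuous_at_imp_continuous_on) simp
qed

text \<open>The affine map with centre a and factor c pulls the small ball back to
  \<open>{x. N x < R}\<close> and scales volume by the power of c. Only this ratio enters later, so
  the volume of the ball itself is never computed.\<close>

lemma emeasure_norm_ball:
  fixes N :: "'a::euclidean_space \<Rightarrow> real"
  assumes N: "is_norm N" and c: "c > 0"
  shows "emeasure lborel {y. N (y - a) < c * R} = ennreal (c ^ DIM('a)) * emeasure lborel {x. N x < R}"
proof -
  note [measurable] = is_norm_measurable[OF N]
  have "{y. N (y - a) < c * R} \<in> sets borel"
    by measurable
  then have "emeasure lborel {y. N (y - a) < c * R}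
      = \<bar>c\<bar> ^ DIM('a) * emeasure lborel ((\<lambda>x. a + c *\<^sub>R x) -` {y. N (y - a) < c * R})"
    using c by (subst lborel_affine[of c a])
      (auto simp: emeasure_density nn_integral_cmult emeasure_distr)
  moreover have "(\<lambda>x. a + c *\<^sub>R x) -` {y. N (y - a) < c * R} = {x. N x < R}"
    using N c by (auto simp: is_norm_def)
  ultimately show ?thesis
    using c by simp
qed

text \<open>\<open>essinf\<close> is a supremum of almost-everywhere lower bounds z. Integrating z
  over S gives the inequality for each z separately, and multiplication by a constant commutes with
  suprema in \<open>ennreal\<close>.\<close>

lemma essinf_times_emeasure_le:
  fixes f :: "'a \<Rightarrow> ennreal"
  assumes f: "f \<in> borel_measurable M" and "S \<in> sets M" "A \<in> sets M" "S \<subseteq> A"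
  shows "essinf (restrict_space M A) f * emeasure M S \<le> emeasure (density M f) S"
proof -
  have "z * emeasure M S \<le> emeasure (density M f) S" if "AE x in restrict_space M A. z \<le> f x" for z
  proof -
    have "AE x in M. x \<in> A \<longrightarrow> z \<le> f x"
      using that assms by (subst (asm) AE_restrict_space_iff) auto
    then have "(\<integral>\<^sup>+x. z * indicator S x \<partial>M) \<le> (\<integral>\<^sup>+x. f x * indicator S x \<partial>M)"
      by (intro nn_integral_mono_AE) (use \<open>S \<subseteq> A\<close> in \<open>auto split: split_indicator\<close>)
    then show ?thesis
      using assms by (simp add: nn_integral_cmult emeasure_density)
  qed
  then have "(SUP z\<in>{z. AE x in restrict_space M A. z \<le> f x}. z * emeasure M S)
      \<le> emeasure (density M f) S"
    by (intro SUP_least) auto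
  then show ?thesis
    unfolding essinf_def by (subst (asm) SUP_mult_right_ennreal[symmetric]) simp
qed

lemma emeasure_le_esssup_times:
  fixes f :: "'a \<Rightarrow> ennreal"
  assumes f: "f \<in> borel_measurable M" and A: "A \<in> sets M"
  shows "emeasure (density M f) A \<le> esssup (restrict_space M A) f * emeasure M A"
proof -
  have "AE x in restrict_space M A. f x \<le> esssup (restrict_space M A) f"
    by (rule esssup_AE)
  then have "AE x in M. x \<in> A \<longrightarrow> f x \<le> esssup (restrict_space M A) f"
    using A by (subst (asm) AE_restrict_space_iff) auto
  then have "(\<integral>\<^sup>+x. f x * indicator A x \<partial>M)
      \<le> (\<integral>\<^sup>+x. esssup (restrict_space M A) f * indicator A x \<partial>M)"
    by (intro nn_integral_mono_AE) (auto split: split_indicator)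
  then show ?thesis
    using assms by (simp add: nn_integral_cmult emeasure_density)
qed

text \<open>Inside the R-ball the density varies by at most the factor exp(\<beta> d), up to null
  sets, so a subset carries at least exp(-\<beta> d) times its share of the volume. The subset used
  is a ball of radius sR/2, whose share is (s/2)^d.\<close>

lemma small_ball:
  fixes N :: "real ^ 'd \<Rightarrow> real"
  assumes N: "is_norm N" and \<gamma>: "\<gamma> > 0" and signal: "signal_condition N R \<gamma> \<beta> P"
    and s: "0 < s" "s \<le> 1" and x: "N x < R"
  shows "\<gamma> * (s / 2) ^ CARD('d) * exp (- \<beta> * real CARD('d)) \<le> measure P {y. N (x - y) < s * R}"
proof -
  note [measurable] = is_norm_measurable[OF N]
  let ?B = "{x. N x < R}" and ?d = "CARD('d)"
  \<comment> \<open>A ball around x itself may leave the R-ball when x is close to its boundary.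
    Shrinking the centre by the factor 1 - s/2 leaves room for radius sR/2, since (1 - s/2)R + sR/2
    = R, and moves it by less than sR/2 away from x.\<close>
  let ?S = "{y. N (y - (1 - s/2) *\<^sub>R x) < (s/2) * R}"
  interpret P: prob_space P
    using signal by (simp add: signal_condition_def)
  obtain f where f[measurable]: "f \<in> borel_measurable borel"
    and P: "P = density lborel (\<lambda>x. ennreal (f x))"
    and ratio: "esssup (restrict_space lborel ?B) (\<lambda>x. ennreal (f x))
      / essinf (restrict_space lborel ?B) (\<lambda>x. ennreal (f x)) \<le> ennreal (exp (\<beta> * real ?d))"
    and mass: "\<gamma> \<le> measure P ?B"
    using signal unfolding signal_condition_def by blast
  have sP: "sets P = sets borel"
    by (simp add: P)
  let ?b = "esssup (restrict_space lborel ?B) (\<lambda>x. ennreal (f x))"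
    and ?a = "essinf (restrict_space lborel ?B) (\<lambda>x. ennreal (f x))"
  let ?V = "emeasure lborel ?B"
  have N_scale: "N (a *\<^sub>R z) = \<bar>a\<bar> * N z" and N_tri: "N (z + w) \<le> N z + N w" for a z w
    using N by (auto simp: is_norm_def)
  have S_sub: "?S \<subseteq> ?B" "?S \<subseteq> {y. N (x - y) < s * R}"
  proof safe
    fix y assume y: "N (y - (1 - s/2) *\<^sub>R x) < (s/2) * R"
    have "N y \<le> N (y - (1 - s/2) *\<^sub>R x) + N ((1 - s/2) *\<^sub>R x)"
      using N_tri[of "y - (1 - s/2) *\<^sub>R x" "(1 - s/2) *\<^sub>R x"] by simp
    also have "N ((1 - s/2) *\<^sub>R x) \<le> (1 - s/2) * R"
      using x s by (simp add: N_scale mult_left_mono)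
    finally show "N y < R"
      using y by (simp add: algebra_simps)
    have "N (x - y) = N (y - x)"
      using N_scale[of "-1" "y - x"] by simp
    also have "\<dots> \<le> N (y - (1 - s/2) *\<^sub>R x) + N ((- (s/2)) *\<^sub>R x)"
      using N_tri[of "y - (1 - s/2) *\<^sub>R x" "(- (s/2)) *\<^sub>R x"] by (simp add: algebra_simps)
    also have "N ((- (s/2)) *\<^sub>R x) \<le> (s/2) * R"
      unfolding N_scale using x s by (simp add: mult_left_mono)
    finally show "N (x - y) < s * R"
      using y by simp
  qed
  have mB: "?B \<in> sets lborel" and mS: "?S \<in> sets lborel"
    by measurable
  have up: "emeasure P ?B \<le> ?b * ?V"
    unfolding P by (rule emeasure_le_esssup_times[OF _ mB]) simp
  have lo: "?a * emeasure lborel S \<le> emeasure P S" if "S \<in> sets lborel" "S \<subseteq> ?B" for S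
    unfolding P by (rule essinf_times_emeasure_le[OF _ that(1) mB that(2)]) simp
  have pos: "emeasure P ?B > 0"
    using mass \<gamma> by (simp add: P.emeasure_eq_measure)
  then have bV: "?b \<noteq> 0" "?V \<noteq> 0"
    using up by auto
  \<comment> \<open>Cancelling \<open>?a\<close> in the \<open>ennreal\<close> quotient requires it
    to be finite and nonzero. It is finite because P has finite mass on a set of positive volume. It
    is nonzero because otherwise the quotient would be infinite, \<open>?b\<close> being
    nonzero.\<close>
  have a_top: "?a \<noteq> top"
  proof
    assume "?a = top"
    then have "emeasure P ?B = top"
      using lo[OF mB order_refl] bV by (simp add: ennreal_top_mult top_unique)
    then show False by simp
  qed
  have a_0: "?a \<noteq> 0"
    using ratio bV by (auto simp: ennreal_divide_zero top_unique)
  have "?b = ?b / ?a * ?a"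
    using a_0 a_top by (simp add: ennreal_divide_times ennreal_divide_self top.not_eq_extremum)
  also have "\<dots> \<le> ennreal (exp (\<beta> * real ?d)) * ?a"
    by (rule mult_right_mono[OF ratio]) simp
  finally have b_le: "?b \<le> ennreal (exp (\<beta> * real ?d)) * ?a" .
  have vol: "emeasure lborel ?S = ennreal ((s/2) ^ ?d) * ?V"
    using emeasure_norm_ball[OF N, of "s/2" "(1 - s/2) *\<^sub>R x" R] s by simp
  have "ennreal ((s/2) ^ ?d) * emeasure P ?B
      \<le> ennreal ((s/2) ^ ?d) * (ennreal (exp (\<beta> * real ?d)) * ?a * ?V)"
    by (intro mult_left_mono order_trans[OF up] mult_right_mono b_le) auto
  also have "\<dots> = ennreal (exp (\<beta> * real ?d)) * (?a * emeasure lborel ?S)"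
    unfolding vol by (simp add: ac_simps)
  also have "\<dots> \<le> ennreal (exp (\<beta> * real ?d)) * emeasure P ?S"
    by (intro mult_left_mono lo mS S_sub) auto
  finally have "(s/2) ^ ?d * measure P ?B \<le> exp (\<beta> * real ?d) * measure P ?S"
    using s by (simp add: P.emeasure_eq_measure ennreal_mult'[symmetric])
  moreover have "measure P ?S \<le> measure P {y. N (x - y) < s * R}"
    by (rule P.finite_measure_mono[OF S_sub(2)]) (unfold sP, measurable)
  moreover have "(s/2) ^ ?d * \<gamma> \<le> (s/2) ^ ?d * measure P ?B"
    using mass s by (intro mult_left_mono) auto
  ultimately have "(s/2) ^ ?d * \<gamma> \<le> exp (\<beta> * real ?d) * measure P {y. N (x - y) < s * R}"
    by (smt (verit) exp_gt_zero mult_left_mono)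
  then show ?thesis
    by (simp add: exp_minus field_simps)
qed

subsection \<open>Swapping two observations\<close>

lemma tv_dist_ge:
  assumes "prob_space \<mu>" "prob_space \<nu>" "A \<in> sets \<mu>"
  shows "measure \<mu> A - measure \<nu> A \<le> tv_dist \<mu> \<nu>"
proof -
  have "\<bar>measure \<mu> B - measure \<nu> B\<bar> \<le> 1" for B
    using prob_space.prob_le_1[OF assms(1), of B] prob_space.prob_le_1[OF assms(2), of B]
      measure_nonneg[of \<mu> B] measure_nonneg[of \<nu> B] by linarith
  \<comment> \<open>A supremum of reals dominates its members only when the family is bounded above;
    here 1 is a bound because both measures are probabilities.\<close>
  then have "bdd_above ((\<lambda>A. \<bar>measure \<mu> A - measure \<nu> A\<bar>) ` sets \<mu>)"
    by (intro bdd_aboveI2)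
  then have "\<bar>measure \<mu> A - measure \<nu> A\<bar> \<le> tv_dist \<mu> \<nu>"
    unfolding tv_dist_def using assms(3) by (intro cSUP_upper)
  then show ?thesis by linarith
qed

lemma tv_dist_le_1:
  assumes "prob_space \<mu>" "prob_space \<nu>"
  shows "tv_dist \<mu> \<nu> \<le> 1"
  unfolding tv_dist_def
proof (rule cSUP_least)
  show "sets \<mu> \<noteq> {}" by auto
  show "\<bar>measure \<mu> B - measure \<nu> B\<bar> \<le> 1" for B
    using prob_space.prob_le_1[OF assms(1), of B] prob_space.prob_le_1[OF assms(2), of B]
      measure_nonneg[of \<mu> B] measure_nonneg[of \<nu> B] by linarith
qed

text \<open>With v = (u' - u)/\<sigma>, the pair (u' + \<sigma> a, u + \<sigma> b) equals (u +
  \<sigma> (a + v), u' + \<sigma> (b - v)). Swapping the two centres is thus the same as shifting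
  the unscaled noises by v and -v, which is what the noise condition controls; closeness of u and u'
  says N v < R.\<close>

lemma noise_swap_le:
  fixes N :: "real ^ 'd \<Rightarrow> real"
  assumes N: "is_norm N" and noise: "noise_condition N R \<beta> Q" and \<sigma>: "\<sigma> > 0"
    and close: "N (u - u') < \<sigma> * R"
    and S: "S \<in> sets (borel \<Otimes>\<^sub>M borel)"
  defines "\<nu> \<equiv> distr Q borel ((*\<^sub>R) \<sigma>)"
  shows "emeasure (\<nu> \<Otimes>\<^sub>M \<nu>) {(a, b). (u' + a, u + b) \<in> S}
    \<le> emeasure (\<nu> \<Otimes>\<^sub>M \<nu>) {(a, b). (u + a, u' + b) \<in> S}
      + ennreal (1 - exp (- \<beta> * real CARD('d)))"
proof -
  let ?\<delta> = "1 - exp (- \<beta> * real CARD('d))"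
  define v where "v = (1 / \<sigma>) *\<^sub>R (u' - u)"
  define Qv where "Qv w = translate Q w" for w
  have Q: "prob_space Q" and sQ[measurable_cong]: "sets Q = sets borel"
    using noise by (auto simp: noise_condition_def)
  interpret Q: prob_space Q by fact
  interpret QQ: pair_prob_space Q Q ..
  have Qv: "prob_space (Qv w)" "sets (Qv w) = sets borel" for w
    unfolding Qv_def translate_def by (auto intro!: Q.prob_space_distr)
  have pair_Qv: "prob_space (Qv w \<Otimes>\<^sub>M Qv w')" for w w'
  proof -
    interpret pair_prob_space "Qv w" "Qv w'"
      using Qv by (simp add: pair_prob_space_def pair_sigma_finite_def prob_space_imp_sigma_finite)
    show ?thesis by unfold_locales
  qed
  have \<nu>\<nu>: "\<nu> \<Otimes>\<^sub>M \<nu> = distr (Q \<Otimes>\<^sub>M Q) (borel \<Otimes>\<^sub>M borel) (\<lambda>(a, b). (\<sigma> *\<^sub>R a, \<sigma> *\<^sub>R b))"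
    unfolding \<nu>_def
    by (intro pair_measure_distr prob_space_imp_sigma_finite Q.prob_space_distr) measurable
  have QvQv: "Qv v \<Otimes>\<^sub>M Qv (- v)
      = distr (Q \<Otimes>\<^sub>M Q) (borel \<Otimes>\<^sub>M borel) (\<lambda>(a, b). (a + v, b + - v))"
    unfolding Qv_def translate_def
    by (intro pair_measure_distr prob_space_imp_sigma_finite Q.prob_space_distr) measurable
  have N_v: "N v < R"
  proof -
    have N_scale: "N (a *\<^sub>R z) = \<bar>a\<bar> * N z" for a z
      using N by (simp add: is_norm_def)
    have "v = (- 1 / \<sigma>) *\<^sub>R (u - u')"
      by (simp add: v_def algebra_simps)
    then have "N v = N (u - u') / \<sigma>"
      unfolding N_scale using \<sigma> by (simp only: N_scale) simp
    also have "\<dots> < R"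
      using close \<sigma> by (simp add: field_simps)
    finally show ?thesis .
  qed
  have "tv_dist (Qv v \<Otimes>\<^sub>M Qv (- v)) (Q \<Otimes>\<^sub>M Q)
      \<le> (SUP v\<in>{v. N v < R}. tv_dist (Qv v \<Otimes>\<^sub>M Qv (- v)) (Q \<Otimes>\<^sub>M Q))"
  proof (rule cSUP_upper)
    show "bdd_above ((\<lambda>v. tv_dist (Qv v \<Otimes>\<^sub>M Qv (- v)) (Q \<Otimes>\<^sub>M Q)) ` {v. N v < R})"
      by (intro bdd_aboveI2[where M=1] tv_dist_le_1 pair_Qv) unfold_locales
  qed (use N_v in simp)
  also have "\<dots> \<le> ?\<delta>"
    using noise unfolding noise_condition_def Qv_def by blast
  finally have tv: "tv_dist (Qv v \<Otimes>\<^sub>M Qv (- v)) (Q \<Otimes>\<^sub>M Q) \<le> ?\<delta>" .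
  define T where "T = {(a, b). (u + \<sigma> *\<^sub>R a, u' + \<sigma> *\<^sub>R b) \<in> S}"
  note [measurable] = S
  have T[measurable]: "T \<in> sets (borel \<Otimes>\<^sub>M borel)"
  proof -
    have "(\<lambda>x. (u + \<sigma> *\<^sub>R fst x, u' + \<sigma> *\<^sub>R snd x)) -` S \<inter> space (borel \<Otimes>\<^sub>M borel)
        \<in> sets (borel \<Otimes>\<^sub>M borel)"
      by (rule measurable_sets[OF _ S]) measurable
    then show ?thesis
      by (simp add: T_def space_pair_measure vimage_def case_prod_beta')
  qed
  have shift: "{(a, b). (w + a, w' + b) \<in> S} \<in> sets (borel \<Otimes>\<^sub>M borel)" for w w'
  proof -
    have "(\<lambda>x. (w + fst x, w' + snd x)) -` S \<inter> space (borel \<Otimes>\<^sub>M borel)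
        \<in> sets (borel \<Otimes>\<^sub>M borel)"
      by (rule measurable_sets[OF _ S]) measurable
    then show ?thesis
      by (simp add: space_pair_measure vimage_def case_prod_beta')
  qed
  have spQ: "space Q = UNIV"
    using sets_eq_imp_space_eq[OF sQ] by simp
  have \<sigma>v: "u + \<sigma> *\<^sub>R (a + v) = u' + \<sigma> *\<^sub>R a" "u' + \<sigma> *\<^sub>R (b - v) = u + \<sigma> *\<^sub>R b" for a b
    using \<sigma> by (simp_all add: v_def scaleR_right_distrib scaleR_right_diff_distrib)
  have "emeasure (\<nu> \<Otimes>\<^sub>M \<nu>) {(a, b). (u' + a, u + b) \<in> S}
      = emeasure (Q \<Otimes>\<^sub>M Q) {(a, b). (u' + \<sigma> *\<^sub>R a, u + \<sigma> *\<^sub>R b) \<in> S}"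
    unfolding \<nu>\<nu> by (subst emeasure_distr[OF _ shift])
      (auto simp: space_pair_measure spQ intro!: arg_cong[where f="emeasure _"])
  also have "\<dots> = emeasure (Qv v \<Otimes>\<^sub>M Qv (- v)) T"
    unfolding QvQv by (subst emeasure_distr[OF _ T])
      (auto simp: space_pair_measure spQ T_def \<sigma>v intro!: arg_cong[where f="emeasure _"])
  also have "\<dots> \<le> ennreal (measure (Q \<Otimes>\<^sub>M Q) T + ?\<delta>)"
  proof -
    have "measure (Qv v \<Otimes>\<^sub>M Qv (- v)) T - measure (Q \<Otimes>\<^sub>M Q) T \<le> ?\<delta>"
      using T by (intro order_trans[OF tv_dist_ge tv] pair_Qv)
        (unfold_locales, simp add: Qv cong: sets_pair_measure_cong)
    then show ?thesis
      by (subst finite_measure.emeasure_eq_measure[OF prob_space.finite_measure[OF pair_Qv]])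
        (intro ennreal_leI, simp)
  qed
  also have "\<dots> = emeasure (Q \<Otimes>\<^sub>M Q) T + ennreal ?\<delta>"
  proof -
    \<comment> \<open>\<open>ennreal\<close> sends negative reals to 0, so splitting the sum needs
      \<open>?\<delta>\<close> to be nonnegative. This follows from the noise condition itself,
      total variation being nonnegative.\<close>
    have "0 \<le> tv_dist (Qv v \<Otimes>\<^sub>M Qv (- v)) (Q \<Otimes>\<^sub>M Q)"
      using tv_dist_ge[OF pair_Qv QQ.prob_space_axioms, of "{}" v "- v"] by simp
    then have "0 \<le> ?\<delta>"
      using tv by linarith
    then show ?thesis
      by (simp only: QQ.emeasure_eq_measure ennreal_plus measure_nonneg)
  qed
  also have "emeasure (Q \<Otimes>\<^sub>M Q) T = emeasure (\<nu> \<Otimes>\<^sub>M \<nu>) {(a, b). (u + a, u' + b) \<in> S}"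
    unfolding \<nu>\<nu> by (subst emeasure_distr[OF _ shift])
      (auto simp: space_pair_measure spQ T_def intro!: arg_cong[where f="emeasure _"])
  finally show ?thesis .
qed

text \<open>Fubini, isolating the two coordinates that a transposition exchanges as an inner
  integral over a pair, with all other coordinates frozen at w.\<close>

lemma nn_integral_PiM_insert_insert:
  fixes L :: "'a measure"
  assumes L: "prob_space L" and J: "finite J" "k \<notin> J" "l \<notin> J" "k \<noteq> l"
    and f: "f \<in> borel_measurable (Pi\<^sub>M (insert k (insert l J)) (\<lambda>_. L))"
  shows "integral\<^sup>N (Pi\<^sub>M (insert k (insert l J)) (\<lambda>_. L)) f
    = (\<integral>\<^sup>+w. \<integral>\<^sup>+z. f (w(l := snd z, k := fst z)) \<partial>(L \<Otimes>\<^sub>M L) \<partial>Pi\<^sub>M J (\<lambda>_. L))"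
proof -
  interpret L: prob_space L by fact
  interpret product_sigma_finite "\<lambda>_. L" ..
  interpret LL: pair_sigma_finite L L ..
  have "integral\<^sup>N (Pi\<^sub>M (insert k (insert l J)) (\<lambda>_. L)) f
      = (\<integral>\<^sup>+x. \<integral>\<^sup>+y. f (x(k := y)) \<partial>L \<partial>Pi\<^sub>M (insert l J) (\<lambda>_. L))"
    using J f by (intro product_nn_integral_insert) auto
  also have "\<dots> = (\<integral>\<^sup>+w. \<integral>\<^sup>+b. \<integral>\<^sup>+a. f (w(l := b, k := a)) \<partial>L \<partial>L \<partial>Pi\<^sub>M J (\<lambda>_. L))"
  proof (intro product_nn_integral_insert J)
    have [measurable]: "(\<lambda>(x, y). f (x(k := y))) \<in> borel_measurable (Pi\<^sub>M (insert l J) (\<lambda>_. L) \<Otimes>\<^sub>M L)"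
      using f by measurable
    show "(\<lambda>x. \<integral>\<^sup>+y. f (x(k := y)) \<partial>L) \<in> borel_measurable (Pi\<^sub>M (insert l J) (\<lambda>_. L))"
      by measurable
  qed
  also have "\<dots> = (\<integral>\<^sup>+w. \<integral>\<^sup>+z. f (w(l := snd z, k := fst z)) \<partial>(L \<Otimes>\<^sub>M L) \<partial>Pi\<^sub>M J (\<lambda>_. L))"
  proof (rule nn_integral_cong)
    fix w assume w: "w \<in> space (Pi\<^sub>M J (\<lambda>_. L))"
    have "(\<lambda>z. w(l := snd z, k := fst z)) \<in> L \<Otimes>\<^sub>M L \<rightarrow>\<^sub>M Pi\<^sub>M (insert k (insert l J)) (\<lambda>_. L)"
      by (rule measurable_fun_upd[where J="insert l J"] measurable_fun_upd[where J=J])+ (use w in auto)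
    then have [measurable]: "(\<lambda>z. f (w(l := snd z, k := fst z))) \<in> borel_measurable (L \<Otimes>\<^sub>M L)"
      by (rule measurable_compose[OF _ f])
    show "(\<integral>\<^sup>+b. \<integral>\<^sup>+a. f (w(l := b, k := a)) \<partial>L \<partial>L)
        = (\<integral>\<^sup>+z. f (w(l := snd z, k := fst z)) \<partial>(L \<Otimes>\<^sub>M L))"
      by (subst LL.nn_integral_snd[symmetric]) auto
  qed
  finally show ?thesis .
qed

lemma noise_tuple_swap_le:
  fixes N :: "real ^ 'd \<Rightarrow> real"
  assumes N: "is_norm N" and noise: "noise_condition N R \<beta> Q" and \<sigma>: "\<sigma> > 0"
    and K: "finite K" "k \<in> K" "l \<in> K" "k \<noteq> l"
    and close: "N (c k - c l) < \<sigma> * R"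
    and A: "A \<in> sets (Pi\<^sub>M K (\<lambda>_. borel))"
  defines "\<nu> \<equiv> distr Q borel ((*\<^sub>R) \<sigma>)"
  shows "emeasure (Pi\<^sub>M K (\<lambda>_. \<nu>)) {z\<in>space (Pi\<^sub>M K (\<lambda>_. \<nu>)). (\<lambda>i\<in>K. c (Transposition.transpose k l i) + z i) \<in> A}
    \<le> emeasure (Pi\<^sub>M K (\<lambda>_. \<nu>)) {z\<in>space (Pi\<^sub>M K (\<lambda>_. \<nu>)). (\<lambda>i\<in>K. c i + z i) \<in> A}
      + ennreal (1 - exp (- \<beta> * real CARD('d)))"
proof -
  let ?\<delta> = "ennreal (1 - exp (- \<beta> * real CARD('d)))"
  let ?c' = "\<lambda>i. c (Transposition.transpose k l i)"
  define J where "J = K - {k, l}"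
  have KJ: "K = insert k (insert l J)" and J: "finite J" "k \<notin> J" "l \<notin> J"
    using K by (auto simp: J_def)
  have s\<nu>[measurable_cong]: "sets \<nu> = sets borel" and sp\<nu>: "space \<nu> = UNIV"
    by (simp_all add: \<nu>_def)
  have \<nu>: "prob_space \<nu>"
  proof -
    interpret Q: prob_space Q using noise by (simp add: noise_condition_def)
    have "sets Q = sets borel" using noise by (simp add: noise_condition_def)
    then show ?thesis
      unfolding \<nu>_def by (intro Q.prob_space_distr) (simp cong: measurable_cong_sets)
  qed
  interpret \<nu>: prob_space \<nu> by fact
  interpret \<nu>\<nu>: pair_prob_space \<nu> \<nu> ..
  interpret PJ: prob_space "Pi\<^sub>M J (\<lambda>_. \<nu>)"
    by (intro prob_space_PiM \<nu>)
  have [measurable]: "(\<lambda>z. \<lambda>i\<in>K. e i + z i) \<in> Pi\<^sub>M K (\<lambda>_. \<nu>) \<rightarrow>\<^sub>M Pi\<^sub>M K (\<lambda>_. borel)"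
    for e :: "'a \<Rightarrow> real ^ 'd"
    by measurable
  define E where "E e = {z\<in>space (Pi\<^sub>M K (\<lambda>_. \<nu>)). (\<lambda>i\<in>K. e i + z i) \<in> A}" for e :: "'a \<Rightarrow> real ^ 'd"
  have E[measurable]: "E e \<in> sets (Pi\<^sub>M K (\<lambda>_. \<nu>))" for e
    unfolding E_def using A by measurable
  define G where "G e w = (\<integral>\<^sup>+z. indicator (E e) (w(l := snd z, k := fst z)) \<partial>(\<nu> \<Otimes>\<^sub>M \<nu>))" for e w
  have E_eq: "emeasure (Pi\<^sub>M K (\<lambda>_. \<nu>)) (E e) = (\<integral>\<^sup>+w. G e w \<partial>Pi\<^sub>M J (\<lambda>_. \<nu>))" for e
  proof -
    have "emeasure (Pi\<^sub>M K (\<lambda>_. \<nu>)) (E e) = (\<integral>\<^sup>+z. indicator (E e) z \<partial>Pi\<^sub>M K (\<lambda>_. \<nu>))"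
      by simp
    also have "\<dots> = (\<integral>\<^sup>+w. G e w \<partial>Pi\<^sub>M J (\<lambda>_. \<nu>))"
      unfolding G_def KJ
      by (rule nn_integral_PiM_insert_insert[OF \<nu> J \<open>k \<noteq> l\<close>]) (simp add: KJ[symmetric])
    finally show ?thesis .
  qed
  have G_measurable: "G c \<in> borel_measurable (Pi\<^sub>M J (\<lambda>_. \<nu>))"
  proof -
    have "(\<lambda>x. (fst x)(l := snd (snd x), k := fst (snd x)))
        \<in> Pi\<^sub>M J (\<lambda>_. \<nu>) \<Otimes>\<^sub>M (\<nu> \<Otimes>\<^sub>M \<nu>) \<rightarrow>\<^sub>M Pi\<^sub>M K (\<lambda>_. \<nu>)"
      by (rule measurable_fun_upd[where J="insert l J"] measurable_fun_upd[where J=J])+ (auto simp: KJ)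
    then have "(\<lambda>x. indicator (E c) ((fst x)(l := snd (snd x), k := fst (snd x))) :: ennreal)
        \<in> borel_measurable (Pi\<^sub>M J (\<lambda>_. \<nu>) \<Otimes>\<^sub>M (\<nu> \<Otimes>\<^sub>M \<nu>))"
      by (rule measurable_compose) simp
    then show ?thesis
      unfolding G_def by (intro \<nu>\<nu>.borel_measurable_nn_integral) (simp add: case_prod_beta')
  qed
  have "G ?c' w \<le> G c w + ?\<delta>" if w: "w \<in> space (Pi\<^sub>M J (\<lambda>_. \<nu>))" for w
  proof -
    \<comment> \<open>The whole observation as a function of its entries at k and l. Both centre
      functions agree with c on J, so one and the same section S of A describes the event before and
      after the swap.\<close>
    define r where "r z = (\<lambda>i\<in>K. if i = k then fst z else if i = l then snd z else c i + w i)"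
      for z :: "(real ^ 'd) \<times> (real ^ 'd)"
    define S where "S = r -` A"
    have r: "r \<in> borel \<Otimes>\<^sub>M borel \<rightarrow>\<^sub>M Pi\<^sub>M K (\<lambda>_. borel)"
      unfolding r_def by measurable
    have S: "S \<in> sets (borel \<Otimes>\<^sub>M borel)"
      using measurable_sets[OF r A] by (simp add: S_def space_pair_measure)
    have G_S: "G e w = emeasure (\<nu> \<Otimes>\<^sub>M \<nu>) {(a, b). (e k + a, e l + b) \<in> S}"
      if e: "\<And>i. i \<in> J \<Longrightarrow> e i = c i" for e
    proof -
      have upd: "w(l := b, k := a) \<in> E e \<longleftrightarrow> (e k + a, e l + b) \<in> S" for a b
      proof -
        have "w(l := b, k := a) \<in> space (Pi\<^sub>M K (\<lambda>_. \<nu>))"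
          using w by (auto simp: space_PiM KJ PiE_def extensional_def sp\<nu>)
        moreover have "(\<lambda>i\<in>K. e i + (w(l := b, k := a)) i) = r (e k + a, e l + b)"
          using e \<open>k \<noteq> l\<close> by (auto simp: r_def KJ fun_eq_iff)
        ultimately show ?thesis
          by (simp add: E_def S_def)
      qed
      have "(\<lambda>x. (e k + fst x, e l + snd x)) -` S \<inter> space (\<nu> \<Otimes>\<^sub>M \<nu>) \<in> sets (\<nu> \<Otimes>\<^sub>M \<nu>)"
        by (rule measurable_sets[OF _ S]) measurable
      then have *: "{(a, b). (e k + a, e l + b) \<in> S} \<in> sets (\<nu> \<Otimes>\<^sub>M \<nu>)"
        by (simp add: space_pair_measure sp\<nu> vimage_def case_prod_beta')
      have "G e w = (\<integral>\<^sup>+z. indicator {(a, b). (e k + a, e l + b) \<in> S} z \<partial>(\<nu> \<Otimes>\<^sub>M \<nu>))"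
        unfolding G_def by (intro nn_integral_cong) (auto simp: indicator_def upd)
      then show ?thesis
        using * by simp
    qed
    have "i \<noteq> k" "i \<noteq> l" if "i \<in> J" for i
      using that J by auto
    then have "G ?c' w = emeasure (\<nu> \<Otimes>\<^sub>M \<nu>) {(a, b). (c l + a, c k + b) \<in> S}"
      "G c w = emeasure (\<nu> \<Otimes>\<^sub>M \<nu>) {(a, b). (c k + a, c l + b) \<in> S}"
      by (simp_all add: G_S)
    then show ?thesis
      using noise_swap_le[OF N noise \<sigma> close S, folded \<nu>_def] by simp
  qed
  then have "(\<integral>\<^sup>+w. G ?c' w \<partial>Pi\<^sub>M J (\<lambda>_. \<nu>)) \<le> (\<integral>\<^sup>+w. G c w + ?\<delta> \<partial>Pi\<^sub>M J (\<lambda>_. \<nu>))"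
    by (rule nn_integral_mono)
  also have "\<dots> = (\<integral>\<^sup>+w. G c w \<partial>Pi\<^sub>M J (\<lambda>_. \<nu>)) + ?\<delta>"
    using G_measurable by (subst nn_integral_add) (auto simp: PJ.emeasure_space_1)
  finally show ?thesis
    by (simp add: E_eq[symmetric] E_def)
qed

subsection \<open>Collisions\<close>

text \<open>With t = mq, the chain is (1 - q)^m <= exp(-t) <= 1/(1 + t). For t <= 1 the last term is
  at most 1 - t/2 because (1 + t)(1 - t/2) >= 1, and for t >= 1 it is at most 1/2.\<close>

lemma one_minus_power_ge:
  fixes q :: real
  assumes "0 \<le> q" "q \<le> 1"
  shows "min 1 (real m * q) / 2 \<le> 1 - (1 - q) ^ m"
proof -
  define t where "t = real m * q"
  have t: "t \<ge> 0"
    using assms by (simp add: t_def)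
  have "(1 - q) ^ m \<le> exp (- q) ^ m"
    using assms exp_ge_add_one_self[of "- q"] by (intro power_mono) auto
  also have "\<dots> = exp (- t)"
    by (simp add: t_def exp_of_nat_mult[symmetric])
  also have "\<dots> \<le> 1 / (1 + t)"
    using exp_ge_add_one_self[of t] t by (simp add: exp_minus divide_simps)
  also have "\<dots> \<le> 1 - min 1 t / 2"
    using t by (auto simp: min_def field_simps intro: mult_left_le)
  finally show ?thesis
    by (simp add: t_def)
qed

text \<open>Condition on coordinate i. Given its value y in B, the remaining coordinates are
  independent and each avoids the D-section at y with probability at most 1 - q, so all of them
  avoid it with probability at most (1 - q)^(card J).\<close>

lemma collision_probability:
  assumes L: "prob_space L" and J: "finite J" "i \<notin> J"
    and D: "D \<in> sets (L \<Otimes>\<^sub>M L)" and B: "B \<in> sets L"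
    and q: "0 \<le> q" "q \<le> 1" "\<And>x. x \<in> B \<Longrightarrow> q \<le> measure L {y\<in>space L. (x, y) \<in> D}"
  defines "PL \<equiv> Pi\<^sub>M (insert i J) (\<lambda>_. L)"
  shows "measure L B * (1 - (1 - q) ^ card J)
    \<le> measure PL {x\<in>space PL. \<exists>j\<in>J. (x i, x j) \<in> D}"
proof -
  interpret L: prob_space L by fact
  interpret product_sigma_finite "\<lambda>_. L" ..
  interpret PL: prob_space PL
    unfolding PL_def by (intro prob_space_PiM L)
  note [measurable] = D B
  let ?m = "card J"
  define F where "F = {x\<in>space PL. \<forall>j\<in>J. (x i, x j) \<notin> D}"
  have comp: "(\<lambda>x. x j) \<in> PL \<rightarrow>\<^sub>M L" if "j \<in> insert i J" for j
    unfolding PL_def using that by (rule measurable_component_singleton)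
  have pairs[measurable]: "(\<lambda>x. (x i, x j)) \<in> PL \<rightarrow>\<^sub>M L \<Otimes>\<^sub>M L" if "j \<in> J" for j
    by (intro measurable_Pair comp) (use that in auto)
  have F[measurable]: "F \<in> sets PL"
    unfolding F_def using J(1) by measurable
  have slice: "{y\<in>space L. (x, y) \<in> D} \<in> sets L" for x
  proof -
    have "Pair x -` D = {y\<in>space L. (x, y) \<in> D}"
      using sets.sets_into_space[OF D] by (auto simp: space_pair_measure)
    then show ?thesis
      using sets_Pair1[OF D, of x] by simp
  qed
  have "emeasure PL F = (\<integral>\<^sup>+x. indicator F x \<partial>PL)"
    by simp
  also have "\<dots> = (\<integral>\<^sup>+y. \<integral>\<^sup>+x. indicator F (x(i := y)) \<partial>Pi\<^sub>M J (\<lambda>_. L) \<partial>L)"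
    unfolding PL_def by (rule product_nn_integral_insert_rev[OF J]) (simp add: PL_def[symmetric])
  also have "\<dots> = (\<integral>\<^sup>+y. emeasure L {z\<in>space L. (y, z) \<notin> D} ^ ?m \<partial>L)"
  proof (rule nn_integral_cong)
    fix y assume y: "y \<in> space L"
    have "(\<integral>\<^sup>+x. indicator F (x(i := y)) \<partial>Pi\<^sub>M J (\<lambda>_. L))
        = (\<integral>\<^sup>+x. indicator (Pi\<^sub>E J (\<lambda>_. {z\<in>space L. (y, z) \<notin> D})) x \<partial>Pi\<^sub>M J (\<lambda>_. L))"
    proof (rule nn_integral_cong)
      fix x assume "x \<in> space (Pi\<^sub>M J (\<lambda>_. L))"
      then have "x(i := y) \<in> F \<longleftrightarrow> x \<in> Pi\<^sub>E J (\<lambda>_. {z\<in>space L. (y, z) \<notin> D})"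
        using J y by (auto simp: F_def PL_def space_PiM PiE_iff extensional_def)
      then show "indicator F (x(i := y)) = (indicator (Pi\<^sub>E J (\<lambda>_. {z\<in>space L. (y, z) \<notin> D})) x :: ennreal)"
        by (simp add: indicator_def)
    qed
    also have "\<dots> = emeasure (Pi\<^sub>M J (\<lambda>_. L)) (Pi\<^sub>E J (\<lambda>_. {z\<in>space L. (y, z) \<notin> D}))"
      using J(1) y by (intro nn_integral_indicator sets_PiM_I_finite) measurable
    also have "\<dots> = emeasure L {z\<in>space L. (y, z) \<notin> D} ^ ?m"
      using J(1) y by (subst emeasure_PiM) auto
    finally show "(\<integral>\<^sup>+x. indicator F (x(i := y)) \<partial>Pi\<^sub>M J (\<lambda>_. L))
        = emeasure L {z\<in>space L. (y, z) \<notin> D} ^ ?m" .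
  qed
  \<comment> \<open>Nothing is known about sections outside B, so there the avoidance probability is
    bounded by 1; after taking complements, that part contributes 0.\<close>
  also have "\<dots> \<le> (\<integral>\<^sup>+y. ennreal ((1 - q) ^ ?m) * indicator B y + indicator (space L - B) y \<partial>L)"
  proof (rule nn_integral_mono)
    fix y assume y: "y \<in> space L"
    have eq: "measure L {z\<in>space L. (y, z) \<notin> D} = 1 - measure L {z\<in>space L. (y, z) \<in> D}"
      using slice[of y] by (subst L.prob_compl[symmetric]) (auto intro!: arg_cong[where f="measure _"])
    have "measure L {z\<in>space L. (y, z) \<notin> D} ^ ?m \<le> (if y \<in> B then (1 - q) ^ ?m else 1)"
      using q y by (auto intro!: power_mono power_le_one simp: eq)
    then show "emeasure L {z\<in>space L. (y, z) \<notin> D} ^ ?m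
        \<le> ennreal ((1 - q) ^ ?m) * indicator B y + indicator (space L - B) y"
      using y by (auto simp: L.emeasure_eq_measure ennreal_power ennreal_le_iff2
          split: split_indicator if_splits)
  qed
  also have "\<dots> = ennreal ((1 - q) ^ ?m * measure L B + (1 - measure L B))"
    using q by (subst nn_integral_add)
      (auto simp: nn_integral_cmult L.emeasure_eq_measure ennreal_mult L.prob_compl)
  finally have "ennreal (measure PL F) \<le> ennreal ((1 - q) ^ ?m * measure L B + (1 - measure L B))"
    by (simp only: PL.emeasure_eq_measure)
  moreover have "0 \<le> (1 - q) ^ ?m * measure L B + (1 - measure L B)"
    using q by simp
  ultimately have "measure PL F \<le> (1 - q) ^ ?m * measure L B + (1 - measure L B)"
    by (simp only: ennreal_le_iff)
  moreover have "measure PL {x\<in>space PL. \<exists>j\<in>J. (x i, x j) \<in> D} = 1 - measure PL F"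
    using F by (subst PL.prob_compl[symmetric]) (auto simp: F_def intro!: arg_cong[where f="measure _"])
  ultimately show ?thesis
    by (simp add: algebra_simps)
qed

subsection \<open>The Bayes risk\<close>

lemma sum_permutes_inv:
  fixes f :: "'a \<Rightarrow> 'b::comm_monoid_add"
  assumes "p permutes K"
  shows "(\<Sum>j\<in>K. f j) = (\<Sum>i\<in>K. f (inv p i))"
  using sum.permute[OF permutes_inv[OF assms], of f] by (simp add: o_def)

section \<open>An exact formula for the risk of a fixed estimator\<close>

context permuted_model
begin

lemma tuple_X_measurable [measurable]: "tuple n X \<in> M \<rightarrow>\<^sub>M tuple_space n"
  and tuple_Z_measurable [measurable]: "tuple n Z \<in> M \<rightarrow>\<^sub>M tuple_space n"
  using iid_X iid_Z unfolding iid_def indep_vars_def tuple_def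
  by (auto intro!: measurable_restrict)

lemma finite_sym_group: "finite (sym_group n)"
  by (simp add: sym_group_def finite_permutations)

lemma card_sym_group_pos: "card (sym_group n) > 0"
proof -
  have "id \<in> sym_group n"
    by (simp add: sym_group_def permutes_id)
  then show ?thesis
    using finite_sym_group by (auto simp: card_gt_0_iff)
qed

lemma \<pi>_in: "\<omega> \<in> space M \<Longrightarrow> \<pi> \<omega> \<in> sym_group n"
  using measurable_space[OF \<pi>_measurable] by simp

lemma \<pi>_event: "\<pi> -` A \<inter> space M \<in> events"
proof -
  have "\<pi> -` A \<inter> space M = \<pi> -` (A \<inter> sym_group n) \<inter> space M"
    using \<pi>_in by auto
  then show ?thesis
    using measurable_sets[OF \<pi>_measurable, of "A \<inter> sym_group n"] by simp
qed

lemma prob_\<pi>_eq: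
  assumes "p \<in> sym_group n"
  shows "prob (\<pi> -` {p} \<inter> space M) = 1 / card (sym_group n)"
proof -
  have "prob (\<pi> -` {p} \<inter> space M) = measure (distr M (count_space (sym_group n)) \<pi>) {p}"
    using assms by (subst measure_distr[OF \<pi>_measurable]) auto
  also have "\<dots> = 1 / card (sym_group n)"
    unfolding \<pi>_uniform using assms finite_sym_group
    by (simp add: measure_uniform_count_measure)
  finally show ?thesis .
qed

text \<open>Conditioned on \<pi> = p, an event of positive probability, the two tuples remain
  independent with their original laws. On rectangles this is the threefold product rule with the
  factor \<open>prob E\<close> cancelled, and rectangles determine the product measure.\<close>

lemma joint_law:
  assumes p: "p \<in> sym_group n" and B: "B \<in> sets (tuple_space n \<Otimes>\<^sub>M tuple_space n)"
  shows "prob {\<omega>\<in>space M. \<pi> \<omega> = p \<and> (tuple n X \<omega>, tuple n Z \<omega>) \<in> B}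
    = measure (distr M (tuple_space n) (tuple n X) \<Otimes>\<^sub>M distr M (tuple_space n) (tuple n Z)) B
      / card (sym_group n)"
proof -
  let ?PX = "distr M (tuple_space n) (tuple n X)" and ?PZ = "distr M (tuple_space n) (tuple n Z)"
  let ?c = "real (card (sym_group n))"
  have c: "?c > 0"
    using card_sym_group_pos by simp
  define E where "E = \<pi> -` {p} \<inter> space M"
  have E: "E \<in> events" and prob_E: "prob E = 1 / ?c"
    using prob_\<pi>_eq[OF p] \<pi>_event by (simp_all add: E_def)
  define U where "U = uniform_measure M E"
  have U: "measure U A = ?c * prob (E \<inter> A)" if "A \<in> events" for A
  proof -
    have "emeasure M E \<noteq> 0"
      using prob_E c by (simp add: emeasure_eq_measure)
    then show ?thesis
      unfolding U_def using that c by (subst measure_uniform_measure) (simp_all add: prob_E)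
  qed
  have sU[measurable_cong]: "sets U = sets M" and spU: "space U = space M"
    by (simp_all add: U_def)
  have "prob_space U"
    unfolding U_def using prob_E c by (intro prob_space_uniform_measure) (auto simp: emeasure_eq_measure)
  then interpret U: prob_space U .
  let ?XZ = "\<lambda>\<omega>. (tuple n X \<omega>, tuple n Z \<omega>)"
  have "?PX \<Otimes>\<^sub>M ?PZ = distr U (tuple_space n \<Otimes>\<^sub>M tuple_space n) ?XZ"
  proof (rule pair_measure_eqI)
    show "sigma_finite_measure ?PX" "sigma_finite_measure ?PZ"
      by (intro prob_space_imp_sigma_finite prob_space_distr tuple_X_measurable tuple_Z_measurable)+
    show "sets (?PX \<Otimes>\<^sub>M ?PZ) = sets (distr U (tuple_space n \<Otimes>\<^sub>M tuple_space n) ?XZ)"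
      by (simp cong: sets_pair_measure_cong)
    fix A C assume "A \<in> sets ?PX" "C \<in> sets ?PZ"
    then have A: "A \<in> sets (tuple_space n)" and C: "C \<in> sets (tuple_space n)"
      by auto
    define F where "F k = (if k = 0 then tuple n X -` A \<inter> space M
      else if k = 1 then tuple n Z -` C \<inter> space M else E)" for k :: nat
    have "prob (\<Inter>k\<in>{0, 1, 2}. F k) = (\<Prod>k\<in>{0, 1, 2}. prob (F k))"
      by (rule indep_setsD[OF mutually_indep]) (use A C p in \<open>auto simp: F_def E_def\<close>)
    also have "(\<Inter>k\<in>{0, 1, 2}. F k) = E \<inter> (?XZ -` (A \<times> C) \<inter> space M)"
      by (auto simp: F_def)
    finally have "?c * prob (E \<inter> (?XZ -` (A \<times> C) \<inter> space M))
        = prob (tuple n X -` A \<inter> space M) * prob (tuple n Z -` C \<inter> space M)"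
      using c by (simp add: F_def prob_E)
    moreover have "measure U (?XZ -` (A \<times> C) \<inter> space M)
        = ?c * prob (E \<inter> (?XZ -` (A \<times> C) \<inter> space M))"
      using A C by (intro U) measurable
    ultimately have "measure U (?XZ -` (A \<times> C) \<inter> space M)
        = prob (tuple n X -` A \<inter> space M) * prob (tuple n Z -` C \<inter> space M)"
      by simp
    then show "emeasure ?PX A * emeasure ?PZ C
        = emeasure (distr U (tuple_space n \<Otimes>\<^sub>M tuple_space n) ?XZ) (A \<times> C)"
      using A C
      by (simp add: emeasure_distr emeasure_eq_measure U.emeasure_eq_measure ennreal_mult spU
          del: One_nat_def)
  qed
  then have "measure (?PX \<Otimes>\<^sub>M ?PZ) B = measure U (?XZ -` B \<inter> space M)"
    using B by (simp add: measure_distr spU del: One_nat_def)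
  also have "\<dots> = ?c * prob (E \<inter> (?XZ -` B \<inter> space M))"
    using B by (intro U) measurable
  also have "E \<inter> (?XZ -` B \<inter> space M) = {\<omega>\<in>space M. \<pi> \<omega> = p \<and> ?XZ \<omega> \<in> B}"
    by (auto simp: E_def)
  finally show ?thesis
    using c by (simp add: field_simps)
qed

text \<open>The event lives on signals and noises rather than on signals and observations. Its slice
  at fixed x is then an event of the noise alone, and slices for different p are measured under the
  same law.\<close>

definition error_event where
  "error_event ph p j = {(x, z)\<in>space (tuple_space n \<Otimes>\<^sub>M tuple_space n).
     ph (x, \<lambda>k\<in>{1..n}. x (p k) + z k) j \<noteq> p j}"
  for ph :: "(nat \<Rightarrow> real ^ 'd) \<times> (nat \<Rightarrow> real ^ 'd) \<Rightarrow> nat \<Rightarrow> nat"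

lemma error_event_measurable:
  assumes ph: "ph \<in> estimators n" and p: "p \<in> sym_group n"
  shows "error_event ph p j \<in> sets (tuple_space n \<Otimes>\<^sub>M tuple_space n)"
proof -
  let ?T = "tuple_space n :: (nat \<Rightarrow> real ^ 'd) measure"
  let ?g = "\<lambda>xz. ph (fst xz, \<lambda>k\<in>{1..n}. fst xz (p k) + snd xz k)"
  have "(\<lambda>xz. fst xz (p k) + snd xz k) \<in> borel_measurable (?T \<Otimes>\<^sub>M ?T)" if "k \<in> {1..n}" for k
  proof -
    have "p k \<in> {1..n}"
      using that p permutes_in_image[of p "{1..n}"] unfolding sym_group_def by blast
    then show ?thesis
      using that by measurable
  qed
  then have "(\<lambda>xz. (fst xz, \<lambda>k\<in>{1..n}. fst xz (p k) + snd xz k)) \<in> ?T \<Otimes>\<^sub>M ?T \<rightarrow>\<^sub>M ?T \<Otimes>\<^sub>M ?T"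
    by (intro measurable_Pair measurable_restrict measurable_fst) auto
  then have g: "?g \<in> ?T \<Otimes>\<^sub>M ?T \<rightarrow>\<^sub>M count_space (sym_group n)"
    using ph unfolding estimators_def by (rule measurable_compose)
  have "?g -` {q\<in>sym_group n. q j \<noteq> p j} \<inter> space (?T \<Otimes>\<^sub>M ?T) \<in> sets (?T \<Otimes>\<^sub>M ?T)"
    by (rule measurable_sets[OF g]) auto
  moreover have "error_event ph p j = ?g -` {q\<in>sym_group n. q j \<noteq> p j} \<inter> space (?T \<Otimes>\<^sub>M ?T)"
    using measurable_space[OF g] unfolding error_event_def by auto
  ultimately show ?thesis
    by simp
qed

text \<open>Each value p of \<pi> has the same weight, and \<open>joint_law\<close> turns its
  contribution into product-measure probabilities. Errors are indexed by the signal i = p j instead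
  of the position j, so that the same i can be compared under two permutations that give it
  different preimages.\<close>

lemma expectation_hamming:
  assumes ph: "ph \<in> estimators n"
  shows "expectation (\<lambda>\<omega>. hamming_dist n (ph (tuple n X \<omega>, tuple n Y \<omega>)) (\<pi> \<omega>))
    = (\<Sum>p\<in>sym_group n. \<Sum>i\<in>{1..n}.
        measure (distr M (tuple_space n) (tuple n X) \<Otimes>\<^sub>M distr M (tuple_space n) (tuple n Z))
          (error_event ph p (inv p i))) / card (sym_group n)"
proof -
  let ?PXZ = "distr M (tuple_space n) (tuple n X) \<Otimes>\<^sub>M distr M (tuple_space n) (tuple n Z)"
  let ?T = "tuple_space n :: (nat \<Rightarrow> real ^ 'd) measure"
  let ?B = "error_event ph"
  define W where "W p j = {\<omega>\<in>space M. \<pi> \<omega> = p \<and> (tuple n X \<omega>, tuple n Z \<omega>) \<in> ?B p j}" for p j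
  have perm: "p permutes {1..n}" if "p \<in> sym_group n" for p
    using that by (simp add: sym_group_def)
  note B = error_event_measurable[OF ph]
  have W: "W p j \<in> events" if "p \<in> sym_group n" for p j
  proof -
    have "W p j = (\<pi> -` {p} \<inter> space M) \<inter> ((\<lambda>\<omega>. (tuple n X \<omega>, tuple n Z \<omega>)) -` ?B p j \<inter> space M)"
      by (auto simp: W_def)
    moreover have "(\<lambda>\<omega>. (tuple n X \<omega>, tuple n Z \<omega>)) -` ?B p j \<inter> space M \<in> events"
      by (rule measurable_sets[OF _ B[OF that]]) measurable
    ultimately show ?thesis
      using \<pi>_event by simp
  qed
  have "hamming_dist n (ph (tuple n X \<omega>, tuple n Y \<omega>)) (\<pi> \<omega>)
      = (\<Sum>j\<in>{1..n}. \<Sum>p\<in>sym_group n. indicator (W p j) \<omega>)" if \<omega>: "\<omega> \<in> space M" for \<omega>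
    unfolding hamming_dist_def
  proof (rule sum.cong[OF refl])
    fix j assume "j \<in> {1..n}"
    have Y: "tuple n Y \<omega> = (\<lambda>k\<in>{1..n}. tuple n X \<omega> (\<pi> \<omega> k) + tuple n Z \<omega> k)"
      using \<omega> permutes_in_image[OF perm[OF \<pi>_in[OF \<omega>]]]
      by (auto simp: tuple_def Y_eq fun_eq_iff)
    have "(tuple n X \<omega>, tuple n Z \<omega>) \<in> space (?T \<Otimes>\<^sub>M ?T)"
      by (simp add: space_pair_measure space_PiM tuple_def)
    then have "indicator (W p j) \<omega> = (if p = \<pi> \<omega> then
        of_bool (ph (tuple n X \<omega>, tuple n Y \<omega>) j \<noteq> \<pi> \<omega> j) else 0 :: real)" for p
      using \<omega> by (auto simp: W_def error_event_def Y indicator_def)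
    then show "of_bool (ph (tuple n X \<omega>, tuple n Y \<omega>) j \<noteq> \<pi> \<omega> j)
        = (\<Sum>p\<in>sym_group n. indicator (W p j) \<omega> :: real)"
      using \<pi>_in[OF \<omega>] finite_sym_group by (simp add: sum.delta)
  qed
  then have "expectation (\<lambda>\<omega>. hamming_dist n (ph (tuple n X \<omega>, tuple n Y \<omega>)) (\<pi> \<omega>))
      = expectation (\<lambda>\<omega>. \<Sum>j\<in>{1..n}. \<Sum>p\<in>sym_group n. indicator (W p j) \<omega>)"
    by (intro Bochner_Integration.integral_cong refl)
  also have "\<dots> = (\<Sum>j\<in>{1..n}. \<Sum>p\<in>sym_group n. prob (W p j))"
  proof -
    have int: "integrable M (indicator (W p j) :: 'w \<Rightarrow> real)" if "p \<in> sym_group n" for p j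
      by (rule integrable_real_indicator) (simp_all add: W that emeasure_eq_measure)
    have "expectation (\<lambda>\<omega>. \<Sum>p\<in>sym_group n. indicator (W p j) \<omega>)
        = (\<Sum>p\<in>sym_group n. prob (W p j))" for j
      by (subst Bochner_Integration.integral_sum) (simp_all add: int W)
    then show ?thesis
      by (subst Bochner_Integration.integral_sum)
        (simp_all add: int Bochner_Integration.integrable_sum)
  qed
  also have "\<dots> = (\<Sum>p\<in>sym_group n. \<Sum>j\<in>{1..n}. measure ?PXZ (?B p j) / card (sym_group n))"
    by (subst sum.swap) (intro sum.cong refl, simp add: W_def joint_law B del: One_nat_def)
  also have "\<dots> = (\<Sum>p\<in>sym_group n. \<Sum>i\<in>{1..n}. measure ?PXZ (?B p (inv p i)) / card (sym_group n))"
    by (intro sum.cong refl sum_permutes_inv perm)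
  also have "\<dots> = (\<Sum>p\<in>sym_group n. \<Sum>i\<in>{1..n}. measure ?PXZ (?B p (inv p i))) / card (sym_group n)"
    by (simp add: sum_divide_distrib)
  finally show ?thesis .
qed

end

text \<open>Since n <= 2(n - 1), the right-hand side is at least \<gamma>^2 e^3 / 8 times the
  minimum. The stated constant follows from exp(-7t) = e^7 <= e^3 and 1/32 <= 1/8.\<close>

lemma rate_le_collision_bound:
  fixes \<gamma> s e t :: real
  assumes \<gamma>: "0 < \<gamma>" "\<gamma> \<le> 1" and t: "0 \<le> t" and s: "s \<ge> 0" and n: "n \<ge> 3"
    and e: "e = exp (- t)"
  shows "\<gamma>\<^sup>2 / 32 * exp (- 7 * t) * min ((real n)\<^sup>2 * s) (real n)
    \<le> e / 2 * (real n * (\<gamma> * (min 1 (real (n - 1) * (\<gamma> * e\<^sup>2 * min 1 s)) / 2)))"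
proof -
  have e01: "0 < e" "e \<le> 1"
    using e t by auto
  have "exp (- 7 * t) = e ^ 7"
    unfolding e by (simp add: exp_of_nat_mult[symmetric])
  also have "\<dots> \<le> e ^ 3"
    using e01 by (intro power_decreasing) auto
  finally have e7: "exp (- 7 * t) \<le> e ^ 3" .
  define g where "g = \<gamma> * e\<^sup>2"
  have g: "0 < g" "g \<le> 1"
    using \<gamma> e01 by (auto simp: g_def intro!: mult_le_one power_le_one)
  have "g / 2 * min (real n * s) 1 \<le> min 1 (real (n - 1) * (g * min 1 s))"
  proof -
    have "g / 2 * min (real n * s) 1 \<le> 1"
      using g s by (intro mult_le_one) auto
    moreover have "g / 2 * min (real n * s) 1 \<le> real (n - 1) * (g * min 1 s)"
    proof -
      have "min (real n * s) 1 \<le> real n * min 1 s"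
      proof (cases "s \<le> 1")
        case False
        then have "min (real n * s) 1 \<le> 1" "1 \<le> real n"
          using n by auto
        then show ?thesis
          using False by simp
      qed simp
      also have "\<dots> \<le> (2 * real (n - 1)) * min 1 s"
        using n s by (intro mult_right_mono) auto
      finally have "g / 2 * min (real n * s) 1 \<le> g / 2 * ((2 * real (n - 1)) * min 1 s)"
        using g by (intro mult_left_mono) auto
      then show ?thesis
        by (simp add: mult_ac)
    qed
    ultimately show ?thesis
      by simp
  qed
  then have "e / 2 * (real n * (\<gamma> * (g / 2 * min (real n * s) 1 / 2)))
      \<le> e / 2 * (real n * (\<gamma> * (min 1 (real (n - 1) * (g * min 1 s)) / 2)))"
    using e01 \<gamma> by (intro mult_left_mono divide_right_mono) auto
  moreover have "\<gamma>\<^sup>2 / 32 * exp (- 7 * t) * min ((real n)\<^sup>2 * s) (real n)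
      \<le> e / 2 * (real n * (\<gamma> * (g / 2 * min (real n * s) 1 / 2)))"
  proof -
    have m: "min ((real n)\<^sup>2 * s) (real n) = real n * min (real n * s) 1"
      using n by (simp add: min_mult_distrib_left power2_eq_square mult.assoc)
    have "\<gamma>\<^sup>2 / 32 * exp (- 7 * t) * min ((real n)\<^sup>2 * s) (real n)
        \<le> \<gamma>\<^sup>2 / 8 * e ^ 3 * min ((real n)\<^sup>2 * s) (real n)"
      using e7 s by (intro mult_right_mono mult_mono) auto
    also have "\<dots> = e / 2 * (real n * (\<gamma> * (g / 2 * min (real n * s) 1 / 2)))"
      unfolding m g_def by (simp add: power2_eq_square power3_eq_cube)
    finally show ?thesis .
  qed
  ultimately show ?thesis
    unfolding g_def by linarith
qed

section \<open>The lower bound in Model LD\<close>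

context model_LD
begin

lemma \<beta>_nonneg: "0 \<le> \<beta>"
  using \<beta>_ge ln_ge_zero[of "2::real"] by linarith

definition "Z_law = distr Q borel ((*\<^sub>R) \<sigma>)"

lemma prob_P: "prob_space P" and sets_P [measurable_cong]: "sets P = sets borel"
  using signal by (auto simp: signal_condition_def)

lemma prob_Z_law: "prob_space Z_law" and sets_Z_law [measurable_cong]: "sets Z_law = sets borel"
proof -
  interpret Q: prob_space Q using noise by (simp add: noise_condition_def)
  have "sets Q = sets borel" using noise by (simp add: noise_condition_def)
  then show "prob_space Z_law"
    unfolding Z_law_def by (intro Q.prob_space_distr) (simp cong: measurable_cong_sets)
qed (simp add: Z_law_def)

lemma law_Z:
  assumes "i \<in> {1..n}"
  shows "distr M borel (Z i) = Z_law"
proof -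
  have [measurable]: "Zt i \<in> borel_measurable M"
    using iid_Zt assms unfolding iid_def indep_vars_def by blast
  have "distr M borel (Z i) = distr M borel (\<lambda>\<omega>. \<sigma> *\<^sub>R Zt i \<omega>)"
    using assms by (intro distr_cong) (auto simp: Z_eq)
  also have "\<dots> = distr (distr M borel (Zt i)) borel ((*\<^sub>R) \<sigma>)"
    by (subst distr_distr) (auto simp: o_def)
  finally show ?thesis
    using assms by (simp add: Zt_law Z_law_def)
qed

lemma law_tuples:
  assumes "n \<ge> 1"
  shows "distr M (tuple_space n) (tuple n X) = (\<Pi>\<^sub>M i\<in>{1..n}. P)"
    and "distr M (tuple_space n) (tuple n Z) = (\<Pi>\<^sub>M i\<in>{1..n}. Z_law)"
proof -
  have "distr M (tuple_space n) (tuple n V) = (\<Pi>\<^sub>M i\<in>{1..n}. L)"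
    if "iid M {1..n} V" "\<And>i. i \<in> {1..n} \<Longrightarrow> distr M borel (V i) = L" for V and L :: "(real ^ 'd) measure"
  proof -
    have ind: "indep_vars (\<lambda>_. borel) V {1..n}"
      using that by (simp add: iid_def)
    then have "\<And>i. i \<in> {1..n} \<Longrightarrow> V i \<in> borel_measurable M"
      unfolding indep_vars_def by blast
    then have "distr M (tuple_space n) (\<lambda>\<omega>. \<lambda>i\<in>{1..n}. V i \<omega>)
        = (\<Pi>\<^sub>M i\<in>{1..n}. distr M borel (V i))"
      using ind assms by (subst (asm) indep_vars_iff_distr_eq_PiM') auto
    also have "\<dots> = (\<Pi>\<^sub>M i\<in>{1..n}. L)"
      using that(2) by (intro PiM_cong) auto
    finally show ?thesis
      by (simp add: tuple_def[abs_def])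
  qed
  from this[OF iid_X X_law] this[OF iid_Z law_Z]
  show "distr M (tuple_space n) (tuple n X) = (\<Pi>\<^sub>M i\<in>{1..n}. P)"
    and "distr M (tuple_space n) (tuple n Z) = (\<Pi>\<^sub>M i\<in>{1..n}. Z_law)"
    by auto
qed

definition "PX = (\<Pi>\<^sub>M i\<in>{1..n}. P)"
definition "PZ = (\<Pi>\<^sub>M i\<in>{1..n}. Z_law)"

lemma sets_PX [measurable_cong]: "sets PX = sets (tuple_space n)"
  and sets_PZ [measurable_cong]: "sets PZ = sets (tuple_space n)"
  unfolding PX_def PZ_def by (auto intro!: sets_PiM_cong simp: sets_P sets_Z_law)

lemma prob_PX: "prob_space PX" and prob_PZ: "prob_space PZ"
  unfolding PX_def PZ_def by (auto intro!: prob_space_PiM prob_P prob_Z_law)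

lemma error_event_PXZ:
  assumes "ph \<in> estimators n" "p \<in> sym_group n"
  shows "error_event ph p j \<in> sets (PX \<Otimes>\<^sub>M PZ)"
  using error_event_measurable[OF assms] sets_pair_measure_cong[OF sets_PX sets_PZ] by simp

text \<open>Le Cam's two-point argument. Let k and l be the preimages of i and j under p; after the
  swap the preimage of i is l. An estimate sending l to i is wrong under p, and one not sending l to
  i is wrong under the swapped permutation. The probabilities of sending l to i under the two
  hypotheses differ favourably up to 1 - exp(-\<beta> d), so the two errors add up to at least
  exp(-\<beta> d).\<close>

lemma two_point:
  assumes ph: "ph \<in> estimators n" and p: "p permutes {1..n}"
    and ij: "i \<in> {1..n}" "j \<in> {1..n}" "i \<noteq> j"
    and x: "x \<in> space PX" and close: "N (x i - x j) < \<sigma> * R"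
  shows "ennreal (exp (- \<beta> * real CARD('d)))
    \<le> emeasure PZ (Pair x -` error_event ph p (inv p i))
      + emeasure PZ (Pair x -` error_event ph (Transposition.transpose i j \<circ> p)
          (inv (Transposition.transpose i j \<circ> p) i))"
proof -
  interpret PZ: prob_space PZ by (rule prob_PZ)
  let ?K = "{1..n}" and ?T = "tuple_space n :: (nat \<Rightarrow> real ^ 'd) measure"
  define k l where "k = inv p i" and "l = inv p j"
  have inv_inj: "inj (inv p)" and inv_mem: "inv p m \<in> ?K \<longleftrightarrow> m \<in> ?K" for m
    using permutes_inj[OF permutes_inv[OF p]] permutes_in_image[OF permutes_inv[OF p]] by auto
  have kl: "k \<in> ?K" "l \<in> ?K" "k \<noteq> l" and pk: "p k = i" "p l = j"
    using ij by (simp_all only: k_def l_def inv_mem permutes_inverses[OF p] inj_eq[OF inv_inj] not_False_eq_True)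
  define p' where "p' = Transposition.transpose i j \<circ> p"
  have p': "p' permutes ?K"
    unfolding p'_def using ij p by (intro permutes_compose permutes_swap_id)
  have "inv p' i = l"
    using permutes_inverses(2)[OF p', of l] by (simp add: p'_def pk)
  \<comment> \<open>Swapping the values i and j of p is the same as swapping the positions k and l.
    This puts the change of hypothesis in the form treated by
    \<open>noise_tuple_swap_le\<close>.\<close>
  have p'_eq: "p' m = p (Transposition.transpose k l m)" for m
  proof -
    have "p m = i \<longleftrightarrow> m = k" "p m = j \<longleftrightarrow> m = l"
      using pk permutes_inj[OF p] by (auto dest: injD)
    then show ?thesis
      by (auto simp: p'_def Transposition.transpose_def pk)
  qed
  have spT: "space PX = space ?T" "space PZ = space ?T"
    using sets_eq_imp_space_eq[OF sets_PX] sets_eq_imp_space_eq[OF sets_PZ] by auto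
  have ph_meas: "(\<lambda>y. ph (x, y)) \<in> ?T \<rightarrow>\<^sub>M count_space (sym_group n)"
    using ph x unfolding estimators_def spT by measurable
  have ph_perm: "ph (x, y) permutes ?K" if "y \<in> space ?T" for y
    using measurable_space[OF ph_meas that] by (simp add: sym_group_def)
  define A where "A q m = {y\<in>space ?T. q (ph (x, y) m)}" for q and m
  have A: "A q m \<in> sets ?T" for q m
  proof -
    have "(\<lambda>y. ph (x, y)) -` {f\<in>sym_group n. q (f m)} \<inter> space ?T \<in> sets ?T"
      by (rule measurable_sets[OF ph_meas]) auto
    also have "(\<lambda>y. ph (x, y)) -` {f\<in>sym_group n. q (f m)} \<inter> space ?T = A q m"
      using measurable_space[OF ph_meas] by (auto simp: A_def)
    finally show ?thesis .
  qed
  define E where "E c q m = {z\<in>space PZ. (\<lambda>i\<in>?K. c i + z i) \<in> A q m}" for c q m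
  have E: "E c q m \<in> sets PZ" for c q m
  proof -
    have "(\<lambda>z. \<lambda>i\<in>?K. c i + z i) \<in> PZ \<rightarrow>\<^sub>M ?T"
      by measurable
    from measurable_sets[OF this A, of q m] show ?thesis
      by (simp add: E_def vimage_def Int_def conj_commute)
  qed
  define c where "c m = x (p m)" for m
  define c' where "c' m = c (Transposition.transpose k l m)" for m
  have c'_eq: "c' m = x (p' m)" for m
    by (simp add: c'_def c_def p'_eq)
  have slice: "Pair x -` error_event ph r (inv r i) = E (\<lambda>m. x (r m)) (\<lambda>a. a \<noteq> i) (inv r i)"
    if "r permutes ?K" for r
    using x permutes_inverses(1)[OF that] spT
    by (auto simp: error_event_def E_def A_def space_pair_measure space_PiM)
  have swap: "emeasure PZ (E c' (\<lambda>a. a = i) l)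
      \<le> emeasure PZ (E c (\<lambda>a. a = i) l) + ennreal (1 - exp (- \<beta> * real CARD('d)))"
    unfolding E_def c'_def PZ_def Z_law_def
    by (rule noise_tuple_swap_le[OF norm_N noise \<sigma>_pos _ kl _ A]) (use close in \<open>simp_all add: c_def pk\<close>)
  \<comment> \<open>The estimate is itself a permutation, so it cannot send both k and l to
    i.\<close>
  have sub: "E c (\<lambda>a. a = i) l \<subseteq> E c (\<lambda>a. a \<noteq> i) k"
    using kl permutes_inj[OF ph_perm] by (auto simp: E_def A_def dest: injD)
  have compl: "measure PZ (E c' (\<lambda>a. a \<noteq> i) l) = 1 - measure PZ (E c' (\<lambda>a. a = i) l)"
  proof -
    have "(\<lambda>i\<in>?K. c' i + z i) \<in> space ?T" for z
      by (simp add: space_PiM)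
    then have "E c' (\<lambda>a. a \<noteq> i) l = space PZ - E c' (\<lambda>a. a = i) l"
      by (auto simp: E_def A_def)
    then show ?thesis
      using PZ.prob_compl[OF E, of c' "\<lambda>a. a = i" l] by simp
  qed
  let ?e = "exp (- \<beta> * real CARD('d))"
  have "0 \<le> 1 - ?e"
    using \<beta>_nonneg by simp
  then have "measure PZ (E c' (\<lambda>a. a = i) l) \<le> measure PZ (E c (\<lambda>a. a = i) l) + (1 - ?e)"
    using swap by (simp only: PZ.emeasure_eq_measure ennreal_plus[symmetric] measure_nonneg
        ennreal_le_iff add_nonneg_nonneg)
  moreover have "measure PZ (E c (\<lambda>a. a = i) l) \<le> measure PZ (E c (\<lambda>a. a \<noteq> i) k)"
    by (rule PZ.finite_measure_mono[OF sub E])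
  ultimately have "?e \<le> measure PZ (E c (\<lambda>a. a \<noteq> i) k) + measure PZ (E c' (\<lambda>a. a \<noteq> i) l)"
    using compl by linarith
  moreover have "Pair x -` error_event ph p (inv p i) = E c (\<lambda>a. a \<noteq> i) k"
    by (simp add: slice[OF p] c_def[abs_def] k_def)
  moreover have "Pair x -` error_event ph p' (inv p' i) = E c' (\<lambda>a. a \<noteq> i) l"
    using slice[OF p'] unfolding \<open>inv p' i = l\<close> c'_eq[abs_def] .
  ultimately show ?thesis
    unfolding p'_def[symmetric]
    by (simp add: PZ.emeasure_eq_measure ennreal_plus[symmetric] del: ennreal_plus)
qed

text \<open>Left composition with a transposition is a bijection of \<open>sym_group n\<close>.
  Summing \<open>two_point\<close> over all p therefore counts every error probability twice, which
  is the source of the factor 1/2.\<close>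

lemma error_event_ge:
  assumes ph: "ph \<in> estimators n" and i: "i \<in> {1..n}"
  shows "real (card (sym_group n)) * exp (- \<beta> * real CARD('d)) / 2
      * measure PX {x\<in>space PX. \<exists>j\<in>{1..n} - {i}. N (x i - x j) < \<sigma> * R}
    \<le> (\<Sum>p\<in>sym_group n. measure (PX \<Otimes>\<^sub>M PZ) (error_event ph p (inv p i)))"
proof -
  interpret PX: prob_space PX by (rule prob_PX)
  interpret PZ: prob_space PZ by (rule prob_PZ)
  interpret PXZ: pair_prob_space PX PZ ..
  note [measurable] = is_norm_measurable[OF norm_N]
  let ?C = "{x\<in>space PX. \<exists>j\<in>{1..n} - {i}. N (x i - x j) < \<sigma> * R}"
  let ?c = "card (sym_group n)" and ?e = "exp (- \<beta> * real CARD('d))"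
  have perm: "p permutes {1..n}" if "p \<in> sym_group n" for p
    using that by (simp add: sym_group_def)
  have "(\<lambda>x. N (x i - x j)) \<in> borel_measurable PX" if "j \<in> {1..n} - {i}" for j
  proof -
    have "j \<in> {1..n}"
      using that by blast
    then show ?thesis
      using i by measurable
  qed
  then have C: "?C \<in> sets PX"
    by measurable
  define w where "w p x = emeasure PZ (Pair x -` error_event ph p (inv p i))" for p x
  have w_meas: "w p \<in> borel_measurable PX" if "p \<in> sym_group n" for p
    unfolding w_def by (intro PZ.measurable_emeasure_Pair error_event_PXZ ph that)
  have w_eq: "emeasure (PX \<Otimes>\<^sub>M PZ) (error_event ph p (inv p i)) = (\<integral>\<^sup>+x. w p x \<partial>PX)"
    if "p \<in> sym_group n" for p
    unfolding w_def by (intro PZ.emeasure_pair_measure_alt error_event_PXZ ph that)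
  \<comment> \<open>The close partner j, and with it the transposition, depends on x. Hence the
    permutations are paired at each fixed x, before integrating over \<open>PX\<close>.\<close>
  have ptwise: "ennreal (real ?c * ?e) * indicator ?C x \<le> 2 * (\<Sum>p\<in>sym_group n. w p x)"
    if x: "x \<in> space PX" for x
  proof (cases "x \<in> ?C")
    case True
    then obtain j where j: "j \<in> {1..n}" "i \<noteq> j" "N (x i - x j) < \<sigma> * R"
      by blast
    let ?\<tau> = "Transposition.transpose i j"
    have "ennreal (real ?c * ?e) = (\<Sum>p\<in>sym_group n. ennreal ?e)"
      by (simp add: ennreal_mult ennreal_of_nat_eq_real_of_nat)
    also have "\<dots> \<le> (\<Sum>p\<in>sym_group n. w p x + w (?\<tau> \<circ> p) x)"
      unfolding w_def by (intro sum_mono two_point ph perm i j x)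
    also have "\<dots> = (\<Sum>p\<in>sym_group n. w p x) + (\<Sum>p\<in>sym_group n. w (?\<tau> \<circ> p) x)"
      by (rule sum.distrib)
    also have "(\<Sum>p\<in>sym_group n. w (?\<tau> \<circ> p) x) = (\<Sum>p\<in>sym_group n. w p x)"
      unfolding sym_group_def
      by (rule setum_permutations_compose_left[symmetric]) (intro permutes_swap_id i j)
    finally show ?thesis
      using True by (simp add: mult_2)
  qed simp
  have "ennreal (real ?c * ?e * measure PX ?C) = (\<integral>\<^sup>+x. ennreal (real ?c * ?e) * indicator ?C x \<partial>PX)"
    using C by (simp add: nn_integral_cmult_indicator PX.emeasure_eq_measure ennreal_mult)
  also have "\<dots> \<le> (\<integral>\<^sup>+x. 2 * (\<Sum>p\<in>sym_group n. w p x) \<partial>PX)"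
    by (intro nn_integral_mono ptwise)
  also have "\<dots> = 2 * (\<Sum>p\<in>sym_group n. emeasure (PX \<Otimes>\<^sub>M PZ) (error_event ph p (inv p i)))"
    using w_meas by (simp add: nn_integral_cmult nn_integral_sum w_eq borel_measurable_sum)
  also have "\<dots> = ennreal (2 * (\<Sum>p\<in>sym_group n. measure (PX \<Otimes>\<^sub>M PZ) (error_event ph p (inv p i))))"
    by (simp add: PXZ.emeasure_eq_measure ennreal_mult sum_ennreal sum_nonneg)
  finally have "real ?c * ?e * measure PX ?C
      \<le> 2 * (\<Sum>p\<in>sym_group n. measure (PX \<Otimes>\<^sub>M PZ) (error_event ph p (inv p i)))"
    by (rule ennreal_le_iff[THEN iffD1, rotated]) (simp add: sum_nonneg)
  then show ?thesis
    by (simp add: field_simps)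
qed

lemma collision_ge:
  assumes i: "i \<in> {1..n}"
  defines "t \<equiv> \<beta> * real CARD('d)"
  shows "\<gamma> * (min 1 (real (n - 1) * (\<gamma> * (exp (- t))\<^sup>2 * min 1 (\<sigma> ^ CARD('d)))) / 2)
    \<le> measure PX {x\<in>space PX. \<exists>j\<in>{1..n} - {i}. N (x i - x j) < \<sigma> * R}"
proof -
  interpret P: prob_space P by (rule prob_P)
  note [measurable] = is_norm_measurable[OF norm_N]
  let ?d = "CARD('d)" and ?B = "{x. N x < R}"
  \<comment> \<open>Capping at 1 makes \<open>small_ball\<close> applicable; since s <= \<sigma>,
    every point it finds is still within \<sigma> R of x.\<close>
  define s where "s = min 1 \<sigma>"
  define q where "q = \<gamma> * (exp (- t))\<^sup>2 * min 1 (\<sigma> ^ ?d)"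
  have s: "0 < s" "s \<le> 1" "s \<le> \<sigma>"
    using \<sigma>_pos by (auto simp: s_def)
  have s_pow: "s ^ ?d = min 1 (\<sigma> ^ ?d)"
  proof (cases "\<sigma> \<le> 1")
    case True
    then show ?thesis
      using \<sigma>_pos by (simp add: s_def power_le_one min_absorb2)
  next
    case False
    then show ?thesis
      using one_le_power[of \<sigma> ?d] by (simp add: s_def min_absorb1)
  qed
  have mass: "\<gamma> \<le> measure P ?B"
    using signal by (simp add: signal_condition_def)
  then have "\<gamma> \<le> 1"
    using P.prob_le_1 order_trans by blast
  have "0 \<le> t"
    using \<beta>_nonneg by (simp add: t_def)
  have q01: "0 \<le> q" "q \<le> 1"
    using \<open>\<gamma> \<le> 1\<close> \<gamma>_pos \<sigma>_pos \<open>0 \<le> t\<close> by (auto simp: q_def intro!: mult_le_one power_le_one)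
  \<comment> \<open>Here \<beta> >= ln 2 enters: the loss 2^(-d) from halving the radius is absorbed
    into a second factor exp(-t), which is why q contains the square of exp(-t).\<close>
  have half: "exp (- t) \<le> (1/2) ^ ?d"
  proof -
    have "exp (- t) \<le> exp (- ln 2 * real ?d)"
      using \<beta>_ge by (simp add: t_def mult_right_mono)
    also have "\<dots> = (1/2) ^ ?d"
      by (simp add: exp_of_nat2_mult exp_minus inverse_eq_divide power_one_over)
    finally show ?thesis .
  qed
  have q_le: "q \<le> measure P {y\<in>space P. (x, y) \<in> {(x, y). N (x - y) < \<sigma> * R}}" if "x \<in> ?B" for x
  proof -
    have "q = \<gamma> * (exp (- t) * s ^ ?d) * exp (- t)"
      by (simp add: q_def s_pow power2_eq_square)
    also have "\<dots> \<le> \<gamma> * ((1/2) ^ ?d * s ^ ?d) * exp (- t)"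
      using half s \<gamma>_pos by (intro mult_right_mono mult_left_mono) auto
    also have "\<dots> = \<gamma> * (s / 2) ^ ?d * exp (- \<beta> * real ?d)"
      by (simp add: t_def power_mult_distrib[symmetric])
    also have "\<dots> \<le> measure P {y. N (x - y) < s * R}"
      using small_ball[OF norm_N \<gamma>_pos signal s(1,2)] that by simp
    also have "\<dots> \<le> measure P {y. N (x - y) < \<sigma> * R}"
    proof (rule P.finite_measure_mono)
      show "{y. N (x - y) < s * R} \<subseteq> {y. N (x - y) < \<sigma> * R}"
        using mult_right_mono[OF s(3), of R] R_pos by (auto intro: less_le_trans)
      show "{y. N (x - y) < \<sigma> * R} \<in> sets P"
        unfolding sets_P by measurable
    qed
    finally show ?thesis
      using sets_eq_imp_space_eq[OF sets_P] by simp
  qed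
  have D: "{(x, y). N (x - y) < \<sigma> * R} \<in> sets (P \<Otimes>\<^sub>M P)"
  proof -
    have "{z\<in>space (P \<Otimes>\<^sub>M P). N (fst z - snd z) < \<sigma> * R} \<in> sets (P \<Otimes>\<^sub>M P)"
      by measurable
    then show ?thesis
      using sets_eq_imp_space_eq[OF sets_P] by (simp add: space_pair_measure case_prod_beta')
  qed
  have "\<gamma> * (min 1 (real (n - 1) * q) / 2) \<le> measure P ?B * (1 - (1 - q) ^ (n - 1))"
    using mass one_minus_power_ge[OF q01, of "n - 1"] \<gamma>_pos q01 by (intro mult_mono) auto
  also have "n - 1 = card ({1..n} - {i})"
    using i by simp
  also have "measure P ?B * (1 - (1 - q) ^ card ({1..n} - {i}))
      \<le> measure (Pi\<^sub>M (insert i ({1..n} - {i})) (\<lambda>_. P))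
        {x\<in>space (Pi\<^sub>M (insert i ({1..n} - {i})) (\<lambda>_. P)).
          \<exists>j\<in>{1..n} - {i}. (x i, x j) \<in> {(x, y). N (x - y) < \<sigma> * R}}"
    by (rule collision_probability[OF prob_P _ _ D _ q01 q_le]) (simp_all add: sets_P)
  also have "insert i ({1..n} - {i}) = {1..n}"
    using i by auto
  finally show ?thesis
    using i by (simp add: q_def PX_def[symmetric] del: One_nat_def)
qed

text \<open>The collision bound a is the same for every i, so summing over i produces the factor n,
  while the number of permutations cancels against the uniform weight in
  \<open>expectation_hamming\<close>.\<close>

lemma expectation_hamming_ge:
  assumes ph: "ph \<in> estimators n" and n: "n \<ge> 3"
  shows "\<gamma>\<^sup>2 / 32 * exp (- 7 * \<beta> * real CARD('d)) * min ((real n)\<^sup>2 * \<sigma> ^ CARD('d)) (real n)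
    \<le> expectation (\<lambda>\<omega>. hamming_dist n (ph (tuple n X \<omega>, tuple n Y \<omega>)) (\<pi> \<omega>))"
proof -
  interpret P: prob_space P by (rule prob_P)
  define t where "t = \<beta> * real CARD('d)"
  have "0 \<le> t"
    using \<beta>_nonneg by (simp add: t_def)
  have "\<gamma> \<le> measure P {x. N x < R}"
    using signal by (simp add: signal_condition_def)
  then have "\<gamma> \<le> 1"
    using P.prob_le_1 order_trans by blast
  let ?c = "real (card (sym_group n))"
  have c: "?c > 0"
    using card_sym_group_pos by simp
  define a where "a = \<gamma> * (min 1 (real (n - 1) * (\<gamma> * (exp (- t))\<^sup>2 * min 1 (\<sigma> ^ CARD('d)))) / 2)"
  have "?c * exp (- t) / 2 * a \<le> (\<Sum>p\<in>sym_group n. measure (PX \<Otimes>\<^sub>M PZ) (error_event ph p (inv p i)))"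
    if "i \<in> {1..n}" for i
    using collision_ge[OF that, folded t_def, folded a_def] error_event_ge[OF ph that] c
    by (elim order_trans[rotated]) (auto simp: t_def intro!: mult_left_mono)
  then have "(\<Sum>i\<in>{1..n}. ?c * exp (- t) / 2 * a)
      \<le> (\<Sum>i\<in>{1..n}. \<Sum>p\<in>sym_group n. measure (PX \<Otimes>\<^sub>M PZ) (error_event ph p (inv p i)))"
    by (rule sum_mono)
  also have "\<dots> = (\<Sum>p\<in>sym_group n. \<Sum>i\<in>{1..n}. measure (PX \<Otimes>\<^sub>M PZ) (error_event ph p (inv p i)))"
    by (rule sum.swap)
  also have "\<dots> = ?c * expectation (\<lambda>\<omega>. hamming_dist n (ph (tuple n X \<omega>, tuple n Y \<omega>)) (\<pi> \<omega>))"
    using expectation_hamming[OF ph] law_tuples n c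
    by (simp add: PX_def[symmetric] PZ_def[symmetric] del: One_nat_def)
  finally have "exp (- t) / 2 * (real n * a)
      \<le> expectation (\<lambda>\<omega>. hamming_dist n (ph (tuple n X \<omega>, tuple n Y \<omega>)) (\<pi> \<omega>))"
    using c by (simp add: field_simps)
  moreover have "\<gamma>\<^sup>2 / 32 * exp (- 7 * t) * min ((real n)\<^sup>2 * \<sigma> ^ CARD('d)) (real n)
      \<le> exp (- t) / 2 * (real n * a)"
    unfolding a_def using \<open>\<gamma> \<le> 1\<close> \<gamma>_pos \<sigma>_pos \<open>0 \<le> t\<close> n by (intro rate_le_collision_bound) auto
  ultimately show ?thesis
    by (simp add: t_def mult.assoc)
qed

end

theorem theorem1p1:
  fixes M :: "'w measure" and n :: nat
    and X Z Zt Y :: "nat \<Rightarrow> 'w \<Rightarrow> real ^ 'd"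
    and \<pi> :: "'w \<Rightarrow> nat \<Rightarrow> nat"
    and N :: "(real ^ 'd) \<Rightarrow> real"
    and R \<gamma> \<beta> \<sigma> :: real
    and P Q :: "(real ^ 'd) measure"
  assumes model: "model_LD M n X Z \<pi> Y N R \<gamma> \<beta> \<sigma> P Q Zt"
    and n_ge: "n \<ge> 3"
  shows "(INF ph\<in>estimators n.
            prob_space.expectation M
              (\<lambda>\<omega>. hamming_dist n (ph (tuple n X \<omega>, tuple n Y \<omega>)) (\<pi> \<omega>)))
         \<ge> \<gamma>\<^sup>2 / 32 * exp (- 7 * \<beta> * real CARD('d))
             * min ((real n)\<^sup>2 * \<sigma> ^ CARD('d)) (real n)"
proof (rule cINF_greatest)
  \<comment> \<open>A lower bound on every member passes to a real infimum only over a nonempty set;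
    a constant estimator is a witness.\<close>
  have "(\<lambda>_. id) \<in> estimators n"
    by (simp add: estimators_def sym_group_def permutes_id)
  then show "estimators n \<noteq> {}"
    by blast
qed (rule model_LD.expectation_hamming_ge[OF model _ n_ge])

end
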